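(* Let $T$ be a complete first-order theory with $NIP$, $M\models T$, and $M_0^{\Omega}$ a simple randomization of $M$. Then for every $L$-formula $\phi(x;y)$ and all $r<s$ there is a natural number $N$ such that there is no sequence $(\mu_1,\ldots,\mu_N)$ of average measures of elements of $M$ which is shattered by elements in $M_0^\Omega$ for $\phi(x;y)$ and $r<s$.
   Context: For $a_1,\dots,a_k\in M$, the average measure $\mu={\rm Ave}(a_1,\dots,a_k)$ is the Keisler measure in $x$ with $\mu(\phi(x;b))=\frac1k|\{j\le k: M\models\phi(a_j;b)\}|$ for $b\in M$. For a model $M$ of $T$ and an atomless finitely additive probability space $(\Omega_0,\mathcal B_0,\mu_0)$, the simple randomization $M_0^\Omega$ is the set of functions $f:\Omega_0\to M$ with finite image and $f^{-1}(\{m\})\in\mathcal B_0$ for all $m$. A sequence $(\mu_i:i<N)$ of average measures is shattered by elements in $M_0^\Omega$ (equivalently, by averages of elements of $M$) for $\phi(x;y)$ and $r<s$ if for every $I\subseteq\{i:i<N\}$ there are $t\in\mathbb N$ and $b_1^I,\dots,b_t^I\in M$ with $\frac1t\sum_{j=1}^t\mu_i(\phi(x;b^I_j))\le r$ for $i\in I$ and $\frac1t\sum_{j=1}^t\mu_i(\phi(x;b^I_j))\ge s$ for $i\notin I$. *)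

theory Defs
  imports "HOL-Analysis.Analysis"
begin

section \<open>First-order logic with equality\<close>

text \<open>A language is given by its ranked function and relation symbols; constants are function
  symbols of rank 0. The symbol sets may be empty and may have any cardinality.\<close>

record ('f, 'p) lang =
  funs :: "('f \<times> nat) set"
  rels :: "('p \<times> nat) set"

datatype 'f tm = Var nat | App 'f "'f tm list"

datatype ('f, 'p) fm =
    Eq "'f tm" "'f tm"
  | Rel 'p "'f tm list"
  | Neg "('f, 'p) fm"
  | Conj "('f, 'p) fm" "('f, 'p) fm"
  | Ex nat "('f, 'p) fm"

fun wf_tm :: "('f, 'p) lang \<Rightarrow> 'f tm \<Rightarrow> bool" where
  "wf_tm L (Var v) \<longleftrightarrow> True"
| "wf_tm L (App f ts) \<longleftrightarrow> (f, length ts) \<in> funs L \<and> (\<forall>t\<in>set ts. wf_tm L t)"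

fun wf_fm :: "('f, 'p) lang \<Rightarrow> ('f, 'p) fm \<Rightarrow> bool" where
  "wf_fm L (Eq s t) \<longleftrightarrow> wf_tm L s \<and> wf_tm L t"
| "wf_fm L (Rel p ts) \<longleftrightarrow> (p, length ts) \<in> rels L \<and> (\<forall>t\<in>set ts. wf_tm L t)"
| "wf_fm L (Neg \<phi>) \<longleftrightarrow> wf_fm L \<phi>"
| "wf_fm L (Conj \<phi> \<psi>) \<longleftrightarrow> wf_fm L \<phi> \<and> wf_fm L \<psi>"
| "wf_fm L (Ex v \<phi>) \<longleftrightarrow> wf_fm L \<phi>"

fun fv_tm :: "'f tm \<Rightarrow> nat set" where
  "fv_tm (Var v) = {v}"
| "fv_tm (App f ts) = (\<Union>t\<in>set ts. fv_tm t)"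

fun fv :: "('f, 'p) fm \<Rightarrow> nat set" where
  "fv (Eq s t) = fv_tm s \<union> fv_tm t"
| "fv (Rel p ts) = (\<Union>t\<in>set ts. fv_tm t)"
| "fv (Neg \<phi>) = fv \<phi>"
| "fv (Conj \<phi> \<psi>) = fv \<phi> \<union> fv \<psi>"
| "fv (Ex v \<phi>) = fv \<phi> - {v}"

definition sentences :: "('f, 'p) lang \<Rightarrow> ('f, 'p) fm set" where
  "sentences L = {\<sigma>. wf_fm L \<sigma> \<and> fv \<sigma> = {}}"

record ('f, 'p, 'm) struct =
  univ :: "'m set"
  fun_of :: "'f \<Rightarrow> 'm list \<Rightarrow> 'm"
  rel_of :: "'p \<Rightarrow> 'm list \<Rightarrow> bool"

definition tuples :: "('f, 'p, 'm) struct \<Rightarrow> nat \<Rightarrow> 'm list set" where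
  "tuples M n = {as. length as = n \<and> set as \<subseteq> univ M}"

definition is_structure :: "('f, 'p) lang \<Rightarrow> ('f, 'p, 'm) struct \<Rightarrow> bool" where
  "is_structure L M \<longleftrightarrow> univ M \<noteq> {} \<and>
     (\<forall>(f, n)\<in>funs L. \<forall>as\<in>tuples M n. fun_of M f as \<in> univ M)"

fun eval :: "('f, 'p, 'm) struct \<Rightarrow> (nat \<Rightarrow> 'm) \<Rightarrow> 'f tm \<Rightarrow> 'm" where
  "eval M e (Var v) = e v"
| "eval M e (App f ts) = fun_of M f (map (eval M e) ts)"

fun sat :: "('f, 'p, 'm) struct \<Rightarrow> (nat \<Rightarrow> 'm) \<Rightarrow> ('f, 'p) fm \<Rightarrow> bool" where
  "sat M e (Eq s t) \<longleftrightarrow> eval M e s = eval M e t"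
| "sat M e (Rel p ts) \<longleftrightarrow> rel_of M p (map (eval M e) ts)"
| "sat M e (Neg \<phi>) \<longleftrightarrow> \<not> sat M e \<phi>"
| "sat M e (Conj \<phi> \<psi>) \<longleftrightarrow> sat M e \<phi> \<and> sat M e \<psi>"
| "sat M e (Ex v \<phi>) \<longleftrightarrow> (\<exists>m\<in>univ M. sat M (e(v := m)) \<phi>)"

definition holds :: "('f, 'p, 'm) struct \<Rightarrow> ('f, 'p) fm \<Rightarrow> bool" where
  "holds M \<sigma> \<longleftrightarrow> (\<forall>e. range e \<subseteq> univ M \<longrightarrow> sat M e \<sigma>)"

definition is_model :: "('f, 'p) lang \<Rightarrow> ('f, 'p) fm set \<Rightarrow> ('f, 'p, 'm) struct \<Rightarrow> bool" where
  "is_model L T M \<longleftrightarrow> is_structure L M \<and> (\<forall>\<sigma>\<in>T. holds M \<sigma>)"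

text \<open>HOL cannot quantify over all structures of all types inside a formula. Notions
  that refer to ``every model of \<open>T\<close>'' range over the structures whose universe is a subset of the
  following type. It has cardinality at least \<open>2 ^ \<aleph>\<^sub>0 + |L|\<close>, so by downward
  Loewenheim-Skolem any failure of an entailment, and any set of at most \<open>2 ^ \<aleph>\<^sub>0\<close> tuples that
  witnesses the independence property in some model of \<open>T\<close>, already occurs in a model of this
  kind.\<close>

type_synonym ('f, 'p) big = "('f, 'p) fm set"

definition entails :: "('f, 'p) lang \<Rightarrow> ('f, 'p) fm set \<Rightarrow> ('f, 'p) fm \<Rightarrow> bool" where
  "entails L T \<sigma> \<longleftrightarrow>
     (\<forall>N :: ('f, 'p, ('f, 'p) big) struct. is_model L T N \<longrightarrow> holds N \<sigma>)"

definition complete_theory :: "('f, 'p) lang \<Rightarrow> ('f, 'p) fm set \<Rightarrow> bool" where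
  "complete_theory L T \<longleftrightarrow> T \<subseteq> sentences L \<and>
     (\<exists>N :: ('f, 'p, ('f, 'p) big) struct. is_model L T N) \<and>
     (\<forall>\<sigma>\<in>sentences L. entails L T \<sigma> \<or> entails L T (Neg \<sigma>))"


section \<open>Partitioned formulas and NIP\<close>

text \<open>\<open>\<phi>(x;y)\<close> is a formula together with two disjoint finite tuples of variables containing its
  free variables.\<close>

definition partitioned :: "('f, 'p) lang \<Rightarrow> ('f, 'p) fm \<Rightarrow> nat list \<Rightarrow> nat list \<Rightarrow> bool" where
  "partitioned L \<phi> x y \<longleftrightarrow> wf_fm L \<phi> \<and> distinct (x @ y) \<and> fv \<phi> \<subseteq> set x \<union> set y"

text \<open>\<open>M \<Turnstile> \<phi>(a;b)\<close>. Variables outside \<open>x\<close> and \<open>y\<close> get an irrelevant value.\<close>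

definition sat_at ::
  "('f, 'p, 'm) struct \<Rightarrow> ('f, 'p) fm \<Rightarrow> nat list \<Rightarrow> nat list \<Rightarrow> 'm list \<Rightarrow> 'm list \<Rightarrow> bool" where
  "sat_at M \<phi> x y a b \<longleftrightarrow> sat M (\<lambda>v. the (map_of (zip (x @ y) (a @ b)) v)) \<phi>"

definition has_IP_in ::
  "('f, 'p, 'm) struct \<Rightarrow> ('f, 'p) fm \<Rightarrow> nat list \<Rightarrow> nat list \<Rightarrow> bool" where
  "has_IP_in M \<phi> x y \<longleftrightarrow>
     (\<exists>(a :: nat \<Rightarrow> 'm list) (b :: nat set \<Rightarrow> 'm list).
        (\<forall>i. a i \<in> tuples M (length x)) \<and> (\<forall>I. b I \<in> tuples M (length y)) \<and>
        (\<forall>i I. sat_at M \<phi> x y (a i) (b I) \<longleftrightarrow> i \<in> I))"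

definition NIP :: "('f, 'p) lang \<Rightarrow> ('f, 'p) fm set \<Rightarrow> bool" where
  "NIP L T \<longleftrightarrow>
     (\<forall>\<phi> x y. partitioned L \<phi> x y \<longrightarrow>
        (\<forall>N :: ('f, 'p, ('f, 'p) big) struct. is_model L T N \<longrightarrow> \<not> has_IP_in N \<phi> x y))"


section \<open>Keisler measures and average measures\<close>

definition solutions ::
  "('f, 'p, 'm) struct \<Rightarrow> ('f, 'p) fm \<Rightarrow> nat list \<Rightarrow> nat list \<Rightarrow> 'm list \<Rightarrow> 'm list set" where
  "solutions M \<phi> x y b = {a \<in> tuples M (length x). sat_at M \<phi> x y a b}"

definition definable_sets ::
  "('f, 'p) lang \<Rightarrow> ('f, 'p, 'm) struct \<Rightarrow> nat list \<Rightarrow> 'm list set set" where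
  "definable_sets L M x =
     {solutions M \<phi> x y b | \<phi> y b. partitioned L \<phi> x y \<and> b \<in> tuples M (length y)}"

text \<open>A Keisler measure in \<open>x\<close> over \<open>M\<close> assigns a value to each \<open>\<phi>(x;b)\<close>, i.e. to each definable
  subset of \<open>M\<close> in the variables \<open>x\<close>; values on other sets carry no information.\<close>

definition keisler_measure ::
  "('f, 'p) lang \<Rightarrow> ('f, 'p, 'm) struct \<Rightarrow> nat list \<Rightarrow> ('m list set \<Rightarrow> real) \<Rightarrow> bool" where
  "keisler_measure L M x \<mu> \<longleftrightarrow>
     (\<forall>X\<in>definable_sets L M x. 0 \<le> \<mu> X) \<and> \<mu> (tuples M (length x)) = 1 \<and>
     Measure_Space.additive (definable_sets L M x) \<mu>"

definition average_measure ::
  "('f, 'p) lang \<Rightarrow> ('f, 'p, 'm) struct \<Rightarrow> nat list \<Rightarrow> 'm list list \<Rightarrow> ('m list set \<Rightarrow> real) \<Rightarrow> bool"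
  where
  "average_measure L M x as \<mu> \<longleftrightarrow> keisler_measure L M x \<mu> \<and>
     (\<forall>\<phi> y b. partitioned L \<phi> x y \<longrightarrow> b \<in> tuples M (length y) \<longrightarrow>
        \<mu> (solutions M \<phi> x y b) =
          real (card {j. j < length as \<and> sat_at M \<phi> x y (as ! j) b}) / real (length as))"

definition is_average_measure ::
  "('f, 'p) lang \<Rightarrow> ('f, 'p, 'm) struct \<Rightarrow> nat list \<Rightarrow> ('m list set \<Rightarrow> real) \<Rightarrow> bool" where
  "is_average_measure L M x \<mu> \<longleftrightarrow>
     (\<exists>as. as \<noteq> [] \<and> set as \<subseteq> tuples M (length x) \<and> average_measure L M x as \<mu>)"

lemma average_measure_exists:
  assumes "as \<noteq> []" "set as \<subseteq> tuples M (length x)"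
  shows "\<exists>\<mu>. average_measure L M x as \<mu>"
proof -
  define \<mu> :: "'a list set \<Rightarrow> real"
    where "\<mu> X = real (card {j. j < length as \<and> as ! j \<in> X}) / real (length as)" for X
  have mem: "as ! j \<in> tuples M (length x)" if "j < length as" for j
    using assms(2) that by auto
  have "\<mu> (X \<union> Y) = \<mu> X + \<mu> Y" if "X \<inter> Y = {}" for X Y
  proof -
    have "{j. j < length as \<and> as ! j \<in> X \<union> Y} =
        {j. j < length as \<and> as ! j \<in> X} \<union> {j. j < length as \<and> as ! j \<in> Y}"
      by auto
    moreover have "{j. j < length as \<and> as ! j \<in> X} \<inter> {j. j < length as \<and> as ! j \<in> Y} = {}"
      using that by auto
    ultimately show ?thesis
      by (simp add: \<mu>_def card_Un_disjoint add_divide_distrib)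
  qed
  then have "Measure_Space.additive (definable_sets L M x) \<mu>"
    by (simp add: Measure_Space.additive_def)
  moreover have "{j. j < length as \<and> as ! j \<in> tuples M (length x)} = {..<length as}"
    using mem by auto
  then have "\<mu> (tuples M (length x)) = 1"
    using assms(1) by (simp add: \<mu>_def)
  moreover have "\<mu> (solutions M \<phi> x y b) =
      real (card {j. j < length as \<and> sat_at M \<phi> x y (as ! j) b}) / real (length as)" for \<phi> y b
  proof -
    have "{j. j < length as \<and> as ! j \<in> solutions M \<phi> x y b} =
        {j. j < length as \<and> sat_at M \<phi> x y (as ! j) b}"
      using mem by (auto simp: solutions_def)
    then show ?thesis by (simp add: \<mu>_def)
  qed
  moreover have "0 \<le> \<mu> X" for X
    by (simp add: \<mu>_def)
  ultimately show ?thesis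
    unfolding average_measure_def keisler_measure_def by blast
qed


section \<open>Simple randomizations and shattering\<close>

definition atomless_fa_prob_space :: "'w set \<Rightarrow> 'w set set \<Rightarrow> ('w set \<Rightarrow> real) \<Rightarrow> bool" where
  "atomless_fa_prob_space \<Omega> \<B> P \<longleftrightarrow>
     algebra \<Omega> \<B> \<and> (\<forall>A\<in>\<B>. 0 \<le> P A) \<and> P \<Omega> = 1 \<and> Measure_Space.additive \<B> P \<and>
     (\<forall>A\<in>\<B>. 0 < P A \<longrightarrow> (\<exists>B\<in>\<B>. B \<subseteq> A \<and> 0 < P B \<and> P B < P A))"

definition simple_randomization ::
  "('f, 'p, 'm) struct \<Rightarrow> 'w set \<Rightarrow> 'w set set \<Rightarrow> ('w \<Rightarrow> 'm) set" where
  "simple_randomization M \<Omega> \<B> =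
     {f \<in> \<Omega> \<rightarrow>\<^sub>E univ M. finite (f ` \<Omega>) \<and> (\<forall>m\<in>univ M. f -` {m} \<inter> \<Omega> \<in> \<B>)}"

text \<open>Shattering of \<open>(\<mu>\<^sub>i : i < N)\<close> by elements of the simple randomization is, by definition,
  shattering by averages of finitely many parameters from \<open>M\<close>; this depends on \<open>M\<close> only.\<close>

definition shattered ::
  "('f, 'p, 'm) struct \<Rightarrow> ('f, 'p) fm \<Rightarrow> nat list \<Rightarrow> nat list \<Rightarrow> real \<Rightarrow> real \<Rightarrow> nat \<Rightarrow>
   (nat \<Rightarrow> 'm list set \<Rightarrow> real) \<Rightarrow> bool" where
  "shattered M \<phi> x y r s N \<mu> \<longleftrightarrow>
     (\<forall>I \<subseteq> {..<N}. \<exists>(t :: nat) (b :: nat \<Rightarrow> 'm list).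
        0 < t \<and> (\<forall>j<t. b j \<in> tuples M (length y)) \<and>
        (\<forall>i\<in>I. (1 / real t) * (\<Sum>j<t. \<mu> i (solutions M \<phi> x y (b j))) \<le> r) \<and>
        (\<forall>i\<in>{..<N} - I. (1 / real t) * (\<Sum>j<t. \<mu> i (solutions M \<phi> x y (b j))) \<ge> s))"

end

theory Submission
  imports Defs "HOL-Real_Asymp.Real_Asymp"
begin

text \<open>
  By NIP, \<open>\<phi>\<close> has finite VC dimension \<open>d\<close> in \<open>M\<close>: otherwise a small elementary substructure of \<open>M\<close>
  already contains shattered sets of every finite size, and an ultrapower of it has the independence
  property.

  Suppose that \<open>\<mu>\<^sub>0, \<dots>, \<mu>\<^bsub>N-1\<^esub>\<close> are shattered. For each \<open>I\<close> only the \<open>N\<close> values at the \<open>\<mu>\<^sub>i\<close> matter,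
  so the parameters \<open>b\<^sup>I\<close> can be replaced, up to a small error, by a sample of size \<open>O(log N)\<close>. Then
  each \<open>\<mu>\<^sub>i\<close> has to be correct only for \<open>2\<^sup>N\<close> sets \<open>I\<close>, so it can be replaced by an average of \<open>O(N)\<close>
  elements. Now \<open>I\<close> is determined by the traces of its \<open>O(log N)\<close> parameters on a set of \<open>O(N\<^sup>2)\<close>
  elements. By the Sauer-Shelah lemma there are at most \<open>O(N\<^sup>2)\<^sup>d\<close> traces, whence
  \<open>2\<^sup>N \<le> N\<^bsup>O(d log N)\<^esup>\<close>, which is false for large \<open>N\<close>.
\<close>

section \<open>Sampling and the Sauer-Shelah lemma\<close>

text \<open>For \<open>u = - v\<close> negative, \<open>exp (- v) \<le> 1 / (1 + v)\<close>, and
  \<open>(1 + v) * (1 - v + v^2) = 1 + v^3 \<ge> 1\<close>. The bound separates a linear term, which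
  averages out below, from a quadratic one.\<close>

lemma exp_le_quadratic:
  fixes u :: real
  assumes "\<bar>u\<bar> \<le> 1"
  shows "exp u \<le> 1 + u + u\<^sup>2"
proof (cases "u \<ge> 0")
  case True
  then show ?thesis using assms exp_bound[of u] by simp
next
  case False
  define v where "v = - u"
  have v: "0 \<le> v" "v \<le> 1" using False assms by (auto simp: v_def)
  have "exp (- v) \<le> inverse (1 + v)"
    using v exp_ge_add_one_self[of v] by (auto simp: exp_minus)
  also have "\<dots> \<le> 1 - v + v\<^sup>2"
  proof -
    have "(1 + v) * (1 - v + v\<^sup>2) = 1 + v ^ 3" by (simp add: algebra_simps power2_eq_square power3_eq_cube)
    then have "1 \<le> (1 + v) * (1 - v + v\<^sup>2)" using v by simp
    then show ?thesis using v by (simp add: inverse_eq_divide divide_le_eq mult.commute)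
  qed
  finally show ?thesis by (simp add: v_def)
qed

text \<open>Multiplicative weights: the sample is built greedily, each new point being chosen so that the
  exponential potential grows at most by the factor that it has on average.\<close>

lemma exponential_weights_sample:
  fixes g :: "'i \<Rightarrow> 'j \<Rightarrow> real"
  assumes A: "finite A" and J: "finite J" "J \<noteq> {}"
    and g: "\<And>i j. i \<in> A \<Longrightarrow> j \<in> J \<Longrightarrow> \<bar>g i j\<bar> \<le> 1"
    and g0: "\<And>i. i \<in> A \<Longrightarrow> (\<Sum>j\<in>J. g i j) \<le> 0" and l: "0 \<le> l" "l \<le> 1"
  shows "\<exists>q :: nat \<Rightarrow> 'j. (\<forall>m<k. q m \<in> J) \<and>
    (\<Sum>i\<in>A. exp (l * (\<Sum>m<k. g i (q m)))) \<le> real (card A) * exp (l\<^sup>2) ^ k"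
proof (induction k)
  case 0
  then show ?case by simp
next
  case (Suc k)
  then obtain q :: "nat \<Rightarrow> 'j" where q: "\<forall>m<k. q m \<in> J"
    "(\<Sum>i\<in>A. exp (l * (\<Sum>m<k. g i (q m)))) \<le> real (card A) * exp (l\<^sup>2) ^ k" by blast
  \<comment> \<open>\<open>w i\<close> is the weight accumulated at \<open>i\<close> so far; a new
    point \<open>j\<close> multiplies it by \<open>exp (l * g i j)\<close>.\<close>
  define w where "w i = exp (l * (\<Sum>m<k. g i (q m)))" for i
  have w: "w i \<ge> 0" for i by (simp add: w_def)
  have "(\<Sum>j\<in>J. \<Sum>i\<in>A. w i * exp (l * g i j)) = (\<Sum>i\<in>A. w i * (\<Sum>j\<in>J. exp (l * g i j)))"
    by (subst sum.swap) (simp add: sum_distrib_left)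
  also have "\<dots> \<le> (\<Sum>i\<in>A. w i * (real (card J) * exp (l\<^sup>2)))"
  proof (intro sum_mono mult_left_mono w)
    fix i assume i: "i \<in> A"
    \<comment> \<open>The linear term sums to at most 0 over \<open>J\<close>, so the factor is on
      average at most \<open>1 + l^2 \<le> exp (l^2)\<close>.\<close>
    have "(\<Sum>j\<in>J. exp (l * g i j)) \<le> (\<Sum>j\<in>J. (1 + l\<^sup>2) + l * g i j)"
    proof (rule sum_mono)
      fix j assume j: "j \<in> J"
      have "\<bar>l * g i j\<bar> \<le> 1"
        using g[OF i j] l by (simp add: abs_mult mult_le_one)
      then have "exp (l * g i j) \<le> 1 + l * g i j + (l * g i j)\<^sup>2"
        by (rule exp_le_quadratic)
      moreover have "(l * g i j)\<^sup>2 \<le> l\<^sup>2 * 1"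
        unfolding power_mult_distrib using g[OF i j] by (intro mult_left_mono) (auto simp: abs_square_le_1)
      ultimately show "exp (l * g i j) \<le> (1 + l\<^sup>2) + l * g i j" by simp
    qed
    also have "\<dots> = real (card J) * (1 + l\<^sup>2) + l * (\<Sum>j\<in>J. g i j)"
      by (simp add: sum.distrib sum_distrib_left)
    also have "\<dots> \<le> real (card J) * (1 + l\<^sup>2)"
      using g0[OF i] l by (simp add: mult_nonneg_nonpos)
    also have "\<dots> \<le> real (card J) * exp (l\<^sup>2)"
      by (intro mult_left_mono) (auto intro: exp_ge_add_one_self)
    finally show "(\<Sum>j\<in>J. exp (l * g i j)) \<le> real (card J) * exp (l\<^sup>2)" .
  qed
  also have "\<dots> = (\<Sum>j\<in>J. exp (l\<^sup>2) * (\<Sum>i\<in>A. w i))"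
    by (simp add: sum_distrib_left sum_distrib_right mult_ac)
  finally have le: "(\<Sum>j\<in>J. \<Sum>i\<in>A. w i * exp (l * g i j)) \<le> (\<Sum>j\<in>J. exp (l\<^sup>2) * (\<Sum>i\<in>A. w i))" .
  \<comment> \<open>Some point does no worse than the average over \<open>J\<close>.\<close>
  have "\<exists>j\<in>J. (\<Sum>i\<in>A. w i * exp (l * g i j)) \<le> exp (l\<^sup>2) * (\<Sum>i\<in>A. w i)"
  proof (rule ccontr)
    assume "\<not> ?thesis"
    then have "(\<Sum>j\<in>J. exp (l\<^sup>2) * (\<Sum>i\<in>A. w i)) < (\<Sum>j\<in>J. \<Sum>i\<in>A. w i * exp (l * g i j))"
      using J by (intro sum_strict_mono) auto
    with le show False by simp
  qed
  then obtain j where j: "j \<in> J" "(\<Sum>i\<in>A. w i * exp (l * g i j)) \<le> exp (l\<^sup>2) * (\<Sum>i\<in>A. w i)"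
    by blast
  have "(\<Sum>i\<in>A. exp (l * (\<Sum>m<Suc k. g i ((q(k := j)) m)))) = (\<Sum>i\<in>A. w i * exp (l * g i j))"
    by (simp add: w_def exp_add[symmetric] distrib_left)
  also have "\<dots> \<le> exp (l\<^sup>2) * (\<Sum>i\<in>A. w i)" by (rule j)
  also have "\<dots> \<le> exp (l\<^sup>2) * (real (card A) * exp (l\<^sup>2) ^ k)"
    using q(2) by (intro mult_left_mono) (auto simp: w_def)
  finally have "(\<Sum>i\<in>A. exp (l * (\<Sum>m<Suc k. g i ((q(k := j)) m)))) \<le> real (card A) * exp (l\<^sup>2) ^ Suc k"
    by (simp add: mult_ac)
  moreover have "\<forall>m<Suc k. (q(k := j)) m \<in> J" using q(1) j(1) by simp
  ultimately show ?case by blast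
qed

text \<open>A single term of the potential is at most the whole sum. At rate
  \<open>l = e / 2\<close> both \<open>card A\<close> and \<open>exp (l^2) ^ k\<close> are at most
  \<open>exp (e^2 / 4 * k)\<close>, and comparing exponents gives \<open>e * k\<close>. Hence a
  sample of size logarithmic in \<open>card A\<close> suffices.\<close>

lemma small_sample_exists:
  fixes g :: "'i \<Rightarrow> 'j \<Rightarrow> real"
  assumes A: "finite A" and J: "finite J" "J \<noteq> {}"
    and g: "\<And>i j. i \<in> A \<Longrightarrow> j \<in> J \<Longrightarrow> \<bar>g i j\<bar> \<le> 1"
    and g0: "\<And>i. i \<in> A \<Longrightarrow> (\<Sum>j\<in>J. g i j) \<le> 0" and e: "0 < e" "e \<le> 2"
    and k: "real (card A) < exp (e\<^sup>2 / 4 * real k)"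
  shows "\<exists>q :: nat \<Rightarrow> 'j. (\<forall>m<k. q m \<in> J) \<and> (\<forall>i\<in>A. (\<Sum>m<k. g i (q m)) \<le> e * real k)"
proof -
  have "\<exists>q :: nat \<Rightarrow> 'j. (\<forall>m<k. q m \<in> J) \<and>
    (\<Sum>i\<in>A. exp (e / 2 * (\<Sum>m<k. g i (q m)))) \<le> real (card A) * exp ((e / 2)\<^sup>2) ^ k"
    by (rule exponential_weights_sample) (use A J g g0 e in auto)
  then obtain q :: "nat \<Rightarrow> 'j" where q: "\<forall>m<k. q m \<in> J"
    "(\<Sum>i\<in>A. exp (e / 2 * (\<Sum>m<k. g i (q m)))) \<le> real (card A) * exp ((e / 2)\<^sup>2) ^ k" by blast
  have "(\<Sum>m<k. g i (q m)) \<le> e * real k" if i: "i \<in> A" for i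
  proof -
    have "exp (e / 2 * (\<Sum>m<k. g i (q m))) \<le> (\<Sum>i\<in>A. exp (e / 2 * (\<Sum>m<k. g i (q m))))"
      using A i by (intro member_le_sum) auto
    also have "\<dots> \<le> exp (e\<^sup>2 / 4 * real k) * exp ((e / 2)\<^sup>2) ^ k"
      using q(2) k by (meson less_imp_le mult_right_mono order_trans zero_le_power exp_ge_zero)
    also have "\<dots> = exp (e\<^sup>2 / 4 * real k + e\<^sup>2 / 4 * real k)"
      by (simp only: exp_add exp_of_nat_mult[symmetric]) (simp add: power_divide mult.commute)
    finally have "e / 2 * (\<Sum>m<k. g i (q m)) \<le> e / 2 * (e * real k)"
      by (simp add: power2_eq_square)
    then show ?thesis using e by simp
  qed
  with q(1) show ?thesis by blast
qed

section \<open>Shattered sets and the number of traces\<close>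

definition shatters :: "'a set set \<Rightarrow> 'a set \<Rightarrow> bool" where
  "shatters F B \<longleftrightarrow> (\<forall>C\<subseteq>B. \<exists>S\<in>F. S \<inter> B = C)"

text \<open>Pajor's form of the Sauer-Shelah lemma.\<close>

lemma card_le_card_shattered:
  assumes "finite A" and "F \<subseteq> Pow A"
  shows "card F \<le> card {B. B \<subseteq> A \<and> shatters F B}"
  using assms
proof (induction A arbitrary: F rule: finite_induct)
  case empty
  then have "F = {} \<or> F = {{}}" by auto
  moreover have "{B :: 'a set. B \<subseteq> {} \<and> shatters {{}} B} = {{}}" by (auto simp: shatters_def)
  ultimately show ?case by (elim disjE) simp_all
next
  case (insert a A)
  \<comment> \<open>\<open>F0\<close> collects the members of \<open>F\<close> without
    \<open>a\<close>, and \<open>F1\<close> those containing \<open>a\<close>, with \<open>a\<close>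
    removed; so \<open>card F\<close> is the sum of their cardinalities.\<close>
  define F0 where "F0 = {S \<in> F. a \<notin> S}"
  define F1 where "F1 = {S. a \<notin> S \<and> insert a S \<in> F}"
  define H where "H G = {B. B \<subseteq> A \<and> shatters G B}" for G
  have F01: "F0 \<subseteq> Pow A" "F1 \<subseteq> Pow A" using insert by (auto simp: F0_def F1_def)
  then have fin: "finite F0" "finite F1" using insert(1) by (auto intro: finite_subset)
  have finH: "finite (H G)" for G using insert(1) by (auto simp: H_def intro: finite_subset[of _ "Pow A"])
  have "S \<in> insert a ` F1" if "S \<in> F" "a \<in> S" for S
    using that by (intro image_eqI[of _ _ "S - {a}"]) (auto simp: F1_def insert_absorb)
  then have "F = F0 \<union> insert a ` F1"
    by (auto simp: F0_def F1_def)
  moreover have "F0 \<inter> insert a ` F1 = {}" by (auto simp: F0_def)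
  moreover have "inj_on (insert a) F1" by (auto simp: inj_on_def F1_def)
  ultimately have "card F = card F0 + card F1"
    using fin by (metis card_Un_disjoint card_image finite_imageI)
  also have "\<dots> \<le> card (H F0) + card (H F1)"
    using insert.IH[OF F01(1)] insert.IH[OF F01(2)] by (simp add: H_def)
  \<comment> \<open>A set shattered by \<open>F0\<close> or \<open>F1\<close> is shattered by
    \<open>F\<close>. One shattered by both is counted twice, and the second count is charged to the
    set with \<open>a\<close> inserted.\<close>
  also have "\<dots> = card (H F0 \<union> H F1) + card (H F0 \<inter> H F1)"
    by (rule card_Un_Int) (rule finH)+
  also have "card (H F0 \<inter> H F1) = card (insert a ` (H F0 \<inter> H F1))"
    using insert(2) by (intro card_image[symmetric]) (auto simp: inj_on_def H_def)
  also have "card (H F0 \<union> H F1) + card (insert a ` (H F0 \<inter> H F1)) =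
      card ((H F0 \<union> H F1) \<union> insert a ` (H F0 \<inter> H F1))"
    using insert(2) finH by (intro card_Un_disjoint[symmetric]) (auto simp: H_def)
  also have "\<dots> \<le> card {B. B \<subseteq> insert a A \<and> shatters F B}"
  proof (rule card_mono)
    show "finite {B. B \<subseteq> insert a A \<and> shatters F B}" using insert(1) by simp
    have "shatters F B" if "B \<in> H F0 \<union> H F1" for B
      unfolding shatters_def
    proof (intro allI impI)
      fix C assume C: "C \<subseteq> B"
      have aB: "a \<notin> B" using that insert(2) by (auto simp: H_def)
      have "(\<exists>S\<in>F0. S \<inter> B = C) \<or> (\<exists>S\<in>F1. S \<inter> B = C)"
        using that C unfolding H_def shatters_def by blast
      then consider S where "S \<in> F0" "S \<inter> B = C" | S where "S \<in> F1" "S \<inter> B = C"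
        by blast
      then show "\<exists>S\<in>F. S \<inter> B = C"
      proof cases
        case 1
        then show ?thesis by (auto simp: F0_def)
      next
        case (2 S)
        then have "insert a S \<in> F" "insert a S \<inter> B = C" using aB by (auto simp: F1_def)
        then show ?thesis by blast
      qed
    qed
    \<comment> \<open>A trace containing \<open>a\<close> comes from \<open>F1\<close> with
      \<open>a\<close> put back, any other trace from \<open>F0\<close>.\<close>
    moreover have "shatters F (insert a B)" if B: "B \<in> H F0 \<inter> H F1" for B
      unfolding shatters_def
    proof (intro allI impI)
      fix C assume C: "C \<subseteq> insert a B"
      have aB: "a \<notin> B" using B insert(2) by (auto simp: H_def)
      have C': "C - {a} \<subseteq> B" using C by blast
      have sh: "shatters F0 B" "shatters F1 B" using B by (auto simp: H_def)
      show "\<exists>S\<in>F. S \<inter> insert a B = C"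
      proof (cases "a \<in> C")
        case True
        obtain S where "S \<in> F1" "S \<inter> B = C - {a}"
          using sh(2)[unfolded shatters_def, rule_format, OF C'] by blast
        moreover have "insert a S \<inter> insert a B = insert a (S \<inter> B)" by blast
        ultimately have "insert a S \<in> F" "insert a S \<inter> insert a B = C"
          using True by (simp_all add: F1_def insert_absorb)
        then show ?thesis by blast
      next
        case False
        obtain S where "S \<in> F0" "S \<inter> B = C - {a}"
          using sh(1)[unfolded shatters_def, rule_format, OF C'] by blast
        then have "S \<in> F" "S \<inter> insert a B = C" using False by (auto simp: F0_def)
        then show ?thesis by blast
      qed
    qed
    ultimately show "(H F0 \<union> H F1) \<union> insert a ` (H F0 \<inter> H F1) \<subseteq> {B. B \<subseteq> insert a A \<and> shatters F B}"
      by (auto simp: H_def)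
  qed
  finally show ?case .
qed

text \<open>A subset with at most \<open>d\<close> elements is listed and padded with
  \<open>None\<close> to length \<open>d\<close>, and there are \<open>(card A + 1) ^ d\<close> such
  lists.\<close>

lemma card_small_subsets_le:
  assumes "finite A"
  shows "card {B. B \<subseteq> A \<and> card B \<le> d} \<le> (card A + 1) ^ d"
proof -
  define X where "X = {xs. set xs \<subseteq> insert None (Some ` A) \<and> length xs = d}"
  have finX: "finite X" unfolding X_def using assms by (intro finite_lists_length_eq) auto
  have "{B. B \<subseteq> A \<and> card B \<le> d} \<subseteq> (\<lambda>xs. {a. Some a \<in> set xs}) ` X"
  proof
    fix B assume "B \<in> {B. B \<subseteq> A \<and> card B \<le> d}"
    then have B: "B \<subseteq> A" "card B \<le> d" "finite B" using assms by (auto intro: finite_subset)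
    obtain bs where bs: "set bs = B" "length bs = card B"
      using finite_distinct_list[OF B(3)] distinct_card by metis
    have "map Some bs @ replicate (d - card B) None \<in> X"
      using B bs by (auto simp: X_def)
    moreover have "B = {a. Some a \<in> set (map Some bs @ replicate (d - card B) None)}"
      using bs by auto
    ultimately show "B \<in> (\<lambda>xs. {a. Some a \<in> set xs}) ` X" by blast
  qed
  then have "card {B. B \<subseteq> A \<and> card B \<le> d} \<le> card X"
    using finX by (meson card_image_le card_mono finite_imageI le_trans)
  also have "card X = (card A + 1) ^ d"
    unfolding X_def using assms by (subst card_lists_length_eq) (auto simp: card_image)
  finally show ?thesis .
qed

text \<open>The polynomial form of Sauer-Shelah: Pajor's bound counts shattered sets, and these have
  at most \<open>d\<close> elements.\<close>

lemma card_traces_le: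
  assumes A: "finite A" and F: "F \<subseteq> Pow A"
    and d: "\<And>B. B \<subseteq> A \<Longrightarrow> shatters F B \<Longrightarrow> card B \<le> d"
  shows "card F \<le> (card A + 1) ^ d"
proof -
  have "card F \<le> card {B. B \<subseteq> A \<and> shatters F B}"
    by (rule card_le_card_shattered[OF A F])
  also have "\<dots> \<le> card {B. B \<subseteq> A \<and> card B \<le> d}"
    using A d by (intro card_mono) auto
  also have "\<dots> \<le> (card A + 1) ^ d" by (rule card_small_subsets_le[OF A])
  finally show ?thesis .
qed

section \<open>Sample sizes and the counting argument\<close>

text \<open>With \<open>K\<close> about \<open>c * ln N\<close> and \<open>k\<close> about
  \<open>c * N\<close>, the left side of the last inequality is the exponential of
  \<open>O((ln N)^2)\<close>, which \<open>2 ^ N\<close> eventually exceeds.\<close>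

lemma exists_polylog_less_exponential:
  fixes c :: real
  assumes "c > 0"
  obtains N k K :: nat where "0 < k" "0 < K" "real N < exp (real K / c)" "2 ^ N < exp (real k / c)"
    "(N * k + 1) ^ (d * K) < 2 ^ N"
proof -
  have "eventually (\<lambda>n::nat. real d * (c * ln (real n) + 2) * ln (real n * (c * real n + 2) + 1) < real n * ln 2) at_top"
    using assms by real_asymp
  then have "eventually (\<lambda>n::nat. 1 < n \<and> real d * (c * ln (real n) + 2) * ln (real n * (c * real n + 2) + 1) < real n * ln 2) at_top"
    by (intro eventually_conj eventually_gt_at_top)
  from eventually_happens'[OF sequentially_bot this] obtain N :: nat where N: "1 < N"
    "real d * (c * ln (real N) + 2) * ln (real N * (c * real N + 2) + 1) < real N * ln 2"
    by auto
  \<comment> \<open>Floor plus one lies strictly above its argument, whence the strict exponential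
    bounds; the \<open>+ 2\<close> in the asymptotic inequality absorbs the rounding.\<close>
  define K where "K = nat \<lfloor>c * ln (real N)\<rfloor> + 1"
  define k where "k = nat \<lfloor>c * real N\<rfloor> + 1"
  have lnN: "ln (real N) > 0" using N(1) by simp
  then have cl: "0 \<le> c * ln (real N)" "0 \<le> c * real N" using assms by auto
  have K: "c * ln (real N) < real K" "real K \<le> c * ln (real N) + 2"
    unfolding K_def using cl by linarith+
  have k: "c * real N < real k" "real k \<le> c * real N + 2"
    unfolding k_def using cl by linarith+
  have "ln (real N) < real K / c" using K(1) assms by (simp add: field_simps)
  then have "exp (ln (real N)) < exp (real K / c)" by simp
  then have 1: "real N < exp (real K / c)" using N(1) by simp
  have "real N < real k / c" using k(1) assms by (simp add: field_simps)
  then have "exp (real N) < exp (real k / c)" by simp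
  moreover have "(2::real) ^ N \<le> exp 1 ^ N"
    using exp_ge_add_one_self[of 1] by (intro power_mono) auto
  moreover have "exp 1 ^ N = exp (real N)" by (simp add: exp_of_nat_mult[symmetric])
  ultimately have 2: "2 ^ N < exp (real k / c)" by linarith
  have "ln (real (N * k + 1)) \<le> ln (real N * (c * real N + 2) + 1)"
    using k(2) by (intro ln_mono) (auto intro!: mult_left_mono simp: add_pos_nonneg)
  moreover have "0 \<le> ln (real (N * k + 1))" by (rule ln_ge_zero) simp
  ultimately have "real (d * K) * ln (real (N * k + 1)) \<le>
      (real d * (c * ln (real N) + 2)) * ln (real N * (c * real N + 2) + 1)"
    using K(2) cl by (intro mult_mono) (auto intro!: mult_left_mono)
  then have "real (d * K) * ln (real (N * k + 1)) < real N * ln 2" using N(2) by linarith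
  then have "ln (real (N * k + 1) ^ (d * K)) < ln (2 ^ N)"
    by (simp only: ln_realpow)
  then have "real (N * k + 1) ^ (d * K) < 2 ^ N"
    by (subst (asm) ln_less_cancel_iff) (auto simp del: of_nat_add of_nat_mult)
  then have "real ((N * k + 1) ^ (d * K)) < real (2 ^ N)" by simp
  then have "(N * k + 1) ^ (d * K) < 2 ^ N" by (simp only: of_nat_less_iff)
  then show thesis using 1 2 that[of k K N] by (simp add: k_def K_def)
qed

lemma average_in_unit:
  fixes h :: "nat \<Rightarrow> real"
  assumes "\<And>l. l < n \<Longrightarrow> 0 \<le> h l \<and> h l \<le> 1"
  shows "0 \<le> (\<Sum>l<n. h l) / real n" "(\<Sum>l<n. h l) / real n \<le> 1"
proof -
  show "0 \<le> (\<Sum>l<n. h l) / real n" using assms by (auto intro!: sum_nonneg divide_nonneg_nonneg)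
  have "(\<Sum>l<n. h l) \<le> (\<Sum>l<n. 1)" using assms by (intro sum_mono) auto
  then show "(\<Sum>l<n. h l) / real n \<le> 1" by (simp add: divide_le_eq)
qed

text \<open>The sampling lemma is applied to deviations from the mean. The predicate
  \<open>up\<close> says which side of the mean must be controlled at \<open>i\<close>, so each
  index contributes one signed deviation, of absolute value at most 1.\<close>

lemma one_sided_resample:
  fixes h :: "'i \<Rightarrow> nat \<Rightarrow> real"
  assumes A: "finite A" and n: "0 < n" and h: "\<And>i l. i \<in> A \<Longrightarrow> l < n \<Longrightarrow> 0 \<le> h i l \<and> h i l \<le> 1"
    and e: "0 < e" "e \<le> 2" and k: "0 < k" "real (card A) < exp (e\<^sup>2 / 4 * real k)"
    and lo: "\<And>i. i \<in> A \<Longrightarrow> up i \<Longrightarrow> (\<Sum>l<n. h i l) / real n \<le> r"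
    and hi: "\<And>i. i \<in> A \<Longrightarrow> \<not> up i \<Longrightarrow> s \<le> (\<Sum>l<n. h i l) / real n"
  shows "\<exists>q :: nat \<Rightarrow> nat. (\<forall>m<k. q m < n) \<and>
    (\<forall>i\<in>A. up i \<longrightarrow> (\<Sum>m<k. h i (q m)) / real k \<le> r + e) \<and>
    (\<forall>i\<in>A. \<not> up i \<longrightarrow> s - e \<le> (\<Sum>m<k. h i (q m)) / real k)"
proof -
  define v where "v i = (\<Sum>l<n. h i l) / real n" for i
  define g where "g i l = (if up i then h i l - v i else v i - h i l)" for i l
  have v: "0 \<le> v i" "v i \<le> 1" if "i \<in> A" for i
    unfolding v_def using average_in_unit[of n "h i"] h that by auto
  have "\<bar>g i l\<bar> \<le> 1" if "i \<in> A" "l \<in> {..<n}" for i l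
    using v[OF that(1)] h[OF that(1), of l] that(2) by (auto simp: g_def)
  moreover have "(\<Sum>l\<in>{..<n}. g i l) \<le> 0" if "i \<in> A" for i
    using n by (cases "up i") (auto simp: g_def v_def sum_subtractf)
  ultimately obtain q :: "nat \<Rightarrow> nat" where q: "\<forall>m<k. q m \<in> {..<n}"
    "\<forall>i\<in>A. (\<Sum>m<k. g i (q m)) \<le> e * real k"
    using small_sample_exists[of A "{..<n}" g e k] A n e k by auto
  have "(\<Sum>m<k. h i (q m)) / real k \<le> r + e" if i: "i \<in> A" "up i" for i
  proof -
    have "(\<Sum>m<k. h i (q m)) - real k * v i \<le> e * real k"
      using q(2) i by (auto simp: g_def sum_subtractf)
    then have "(\<Sum>m<k. h i (q m)) / real k \<le> v i + e"
      using k(1) by (simp add: field_simps)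
    then show ?thesis using lo[OF i] by (simp add: v_def)
  qed
  moreover have "s - e \<le> (\<Sum>m<k. h i (q m)) / real k" if i: "i \<in> A" "\<not> up i" for i
  proof -
    have "real k * v i - (\<Sum>m<k. h i (q m)) \<le> e * real k"
      using q(2) i by (auto simp: g_def sum_subtractf)
    then have "v i - e \<le> (\<Sum>m<k. h i (q m)) / real k"
      using k(1) by (simp add: field_simps)
    then show ?thesis using hi[OF i] by (simp add: v_def)
  qed
  ultimately show ?thesis using q(1) by blast
qed

text \<open>The combinatorial core, for an arbitrary relation \<open>R\<close> and with truth values
  in place of measures. \<open>N\<close> is fixed before the points and the parameters. Two
  resamplings make every \<open>I\<close> recoverable from \<open>K\<close> traces on at most
  \<open>N * k\<close> points.\<close>

lemma averages_not_shattered: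
  fixes R :: "'a \<Rightarrow> 'b \<Rightarrow> bool" and r s :: real
  assumes vc: "\<forall>B. finite B \<longrightarrow> B \<subseteq> X \<longrightarrow>
      (\<forall>C\<subseteq>B. \<exists>b\<in>Y. \<forall>a\<in>B. R a b \<longleftrightarrow> a \<in> C) \<longrightarrow> card B \<le> d"
    and rs: "r < s"
  shows "\<exists>N::nat. \<forall>(n :: nat \<Rightarrow> nat) \<alpha> (t :: nat set \<Rightarrow> nat) \<beta>.
    (\<forall>i<N. 0 < n i \<and> (\<forall>l<n i. \<alpha> i l \<in> X)) \<longrightarrow>
    (\<forall>I\<subseteq>{..<N}. 0 < t I \<and> (\<forall>j<t I. \<beta> I j \<in> Y)) \<longrightarrow>
    (\<exists>I\<subseteq>{..<N}. \<exists>i<N. if i \<in> I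
      then r < (\<Sum>j<t I. (\<Sum>l<n i. of_bool (R (\<alpha> i l) (\<beta> I j))) / real (n i)) / real (t I)
      else (\<Sum>j<t I. (\<Sum>l<n i. of_bool (R (\<alpha> i l) (\<beta> I j))) / real (n i)) / real (t I) < s)"
proof -
  \<comment> \<open>Two samplings cost \<open>e\<close> each on both sides of the gap,
    \<open>4 * e\<close> in all, so a fifth of \<open>s - r\<close> leaves
    \<open>r + 2 * e < s - 2 * e\<close>. The minimum with 1 ensures
    \<open>e \<le> 2\<close>.\<close>
  define e where "e = min 1 ((s - r) / 5)"
  have e: "0 < e" "e \<le> 2" "r + e + e < s - e - e" using rs by (auto simp: e_def min_def field_simps)
  define c where "c = 4 / e\<^sup>2"
  have c: "c > 0" using e by (simp add: c_def)
  have ce: "m / c = e\<^sup>2 / 4 * m" for m by (simp add: c_def)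
  obtain N k K :: nat where k0: "0 < k" and K0: "0 < K" and K: "real N < exp (e\<^sup>2 / 4 * real K)"
    and k: "2 ^ N < exp (e\<^sup>2 / 4 * real k)" and lt: "(N * k + 1) ^ (d * K) < 2 ^ N"
    by (rule exists_polylog_less_exponential[OF c, of d, unfolded ce])
  have contra: False if n: "\<And>i. i < N \<Longrightarrow> 0 < n i" and \<alpha>: "\<And>i l. i < N \<Longrightarrow> l < n i \<Longrightarrow> \<alpha> i l \<in> X"
    and t: "\<And>I. I \<subseteq> {..<N} \<Longrightarrow> 0 < t I" and \<beta>: "\<And>I j. I \<subseteq> {..<N} \<Longrightarrow> j < t I \<Longrightarrow> \<beta> I j \<in> Y"
    and lo: "\<And>I i. I \<subseteq> {..<N} \<Longrightarrow> i < N \<Longrightarrow> i \<in> I \<Longrightarrow>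
      (\<Sum>j<t I. (\<Sum>l<n i. of_bool (R (\<alpha> i l) (\<beta> I j))) / real (n i)) / real (t I) \<le> r"
    and hi: "\<And>I i. I \<subseteq> {..<N} \<Longrightarrow> i < N \<Longrightarrow> i \<notin> I \<Longrightarrow>
      s \<le> (\<Sum>j<t I. (\<Sum>l<n i. of_bool (R (\<alpha> i l) (\<beta> I j))) / real (n i)) / real (t I)"
    for n :: "nat \<Rightarrow> nat" and \<alpha> and t :: "nat set \<Rightarrow> nat" and \<beta>
  proof -
    define av where "av i b = (\<Sum>l<n i. of_bool (R (\<alpha> i l) b)) / real (n i)" for i b
    have av: "0 \<le> av i b \<and> av i b \<le> 1" for i b
      unfolding av_def by (intro conjI average_in_unit) auto
    \<comment> \<open>First sampling, for fixed \<open>I\<close>: only the \<open>N\<close> averages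
      \<open>av i\<close> have to be preserved, so \<open>K\<close> of the parameters of
      \<open>I\<close> suffice.\<close>
    define sam where "sam I q \<longleftrightarrow> (\<forall>m<K. q m < t I) \<and>
      (\<forall>i\<in>{..<N}. i \<in> I \<longrightarrow> (\<Sum>m<K. av i (\<beta> I (q m))) / real K \<le> r + e) \<and>
      (\<forall>i\<in>{..<N}. i \<notin> I \<longrightarrow> s - e \<le> (\<Sum>m<K. av i (\<beta> I (q m))) / real K)" for I q
    have "\<exists>q. sam I q" if I: "I \<subseteq> {..<N}" for I
      unfolding sam_def
      using lo[OF I, folded av_def] hi[OF I, folded av_def] t[OF I] e K0 K av
      by (intro one_sided_resample[of "{..<N}"]) auto
    then obtain q where sam: "\<And>I. I \<subseteq> {..<N} \<Longrightarrow> sam I (q I)" by metis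
    have q: "\<And>I m. I \<subseteq> {..<N} \<Longrightarrow> m < K \<Longrightarrow> q I m < t I"
      "\<And>I i. I \<subseteq> {..<N} \<Longrightarrow> i < N \<Longrightarrow> i \<in> I \<Longrightarrow> (\<Sum>m<K. av i (\<beta> I (q I m))) / real K \<le> r + e"
      "\<And>I i. I \<subseteq> {..<N} \<Longrightarrow> i < N \<Longrightarrow> i \<notin> I \<Longrightarrow> s - e \<le> (\<Sum>m<K. av i (\<beta> I (q I m))) / real K"
      using sam unfolding sam_def by simp_all
    define \<beta>' where "\<beta>' I m = \<beta> I (q I m)" for I m
    define h where "h I a = (\<Sum>m<K. of_bool (R a (\<beta>' I m))) / real K" for I a
    have h: "0 \<le> h I a \<and> h I a \<le> 1" for I a
      unfolding h_def by (intro conjI average_in_unit) auto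
    \<comment> \<open>Exchanging the sums turns the bounds on the sampled parameters into bounds on
      averages of \<open>h I\<close> over the points of \<open>i\<close>, from which the second
      sampling starts.\<close>
    have swap: "(\<Sum>l<n i. h I (\<alpha> i l)) / real (n i) = (\<Sum>m<K. av i (\<beta>' I m)) / real K" for i I
    proof -
      have "(\<Sum>l<n i. \<Sum>m<K. of_bool (R (\<alpha> i l) (\<beta>' I m)) :: real) =
        (\<Sum>m<K. \<Sum>l<n i. of_bool (R (\<alpha> i l) (\<beta>' I m)))" by (rule sum.swap)
      then show ?thesis
        unfolding h_def av_def by (simp only: sum_divide_distrib[symmetric] divide_divide_eq_left mult.commute)
    qed
    \<comment> \<open>Second sampling, for fixed \<open>i\<close>: the functions to be preserved are
      now the \<open>2 ^ N\<close> many \<open>h I\<close>, hence the size \<open>k\<close> linear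
      in \<open>N\<close>. Membership \<open>i \<in> I\<close> selects the side.\<close>
    define sam' where "sam' i p \<longleftrightarrow> (\<forall>m<k. p m < n i) \<and>
      (\<forall>I\<in>Pow {..<N}. i \<in> I \<longrightarrow> (\<Sum>m<k. h I (\<alpha> i (p m))) / real k \<le> (r + e) + e) \<and>
      (\<forall>I\<in>Pow {..<N}. i \<notin> I \<longrightarrow> (s - e) - e \<le> (\<Sum>m<k. h I (\<alpha> i (p m))) / real k)" for i p
    have "\<exists>p. sam' i p" if i: "i < N" for i
      unfolding sam'_def
      using n[OF i] e k0 k h q(2,3)[OF _ i]
      by (intro one_sided_resample[of "Pow {..<N}"]) (auto simp: swap \<beta>'_def card_Pow)
    then obtain p where sam': "\<And>i. i < N \<Longrightarrow> sam' i (p i)" by metis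
    have p: "\<And>i m. i < N \<Longrightarrow> m < k \<Longrightarrow> p i m < n i"
      "\<And>i I. i < N \<Longrightarrow> I \<subseteq> {..<N} \<Longrightarrow> i \<in> I \<Longrightarrow> (\<Sum>m<k. h I (\<alpha> i (p i m))) / real k \<le> r + e + e"
      "\<And>i I. i < N \<Longrightarrow> I \<subseteq> {..<N} \<Longrightarrow> i \<notin> I \<Longrightarrow> s - e - e \<le> (\<Sum>m<k. h I (\<alpha> i (p i m))) / real k"
      using sam' unfolding sam'_def by simp_all
    define A where "A = (\<lambda>(i, m). \<alpha> i (p i m)) ` ({..<N} \<times> {..<k})"
    have finA: "finite A" by (simp add: A_def)
    have AX: "A \<subseteq> X" using p(1) \<alpha> by (auto simp: A_def)
    have cA: "card A \<le> N * k" unfolding A_def by (rule order_trans[OF card_image_le]) auto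
    define F where "F = (\<lambda>b. {a \<in> A. R a b}) ` Y"
    have FA: "F \<subseteq> Pow A" by (auto simp: F_def)
    have finF: "finite F" using FA finA by (auto intro: finite_subset)
    have cF: "card F \<le> (card A + 1) ^ d"
    proof (rule card_traces_le[OF finA FA])
      fix B assume B: "B \<subseteq> A" "shatters F B"
      show "card B \<le> d"
      proof (rule mp[OF mp[OF mp[OF spec[OF vc]]]])
        show "finite B" "B \<subseteq> X" using B finA AX by (auto intro: finite_subset)
        show "\<forall>C\<subseteq>B. \<exists>b\<in>Y. \<forall>a\<in>B. R a b \<longleftrightarrow> a \<in> C"
        proof (intro allI impI)
          fix C assume "C \<subseteq> B"
          then obtain S where "S \<in> F" "S \<inter> B = C" using B(2) unfolding shatters_def by blast
          then obtain b where "b \<in> Y" "{a \<in> A. R a b} \<inter> B = C" by (auto simp: F_def)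
          then show "\<exists>b\<in>Y. \<forall>a\<in>B. R a b \<longleftrightarrow> a \<in> C" using B(1) by blast
        qed
      qed
    qed
    \<comment> \<open>\<open>code I\<close> lists the traces on \<open>A\<close> of the sampled
      parameters of \<open>I\<close>. It determines \<open>h I\<close> on \<open>A\<close>, hence
      all sampled averages, and the gap between \<open>r + 2 * e\<close> and
      \<open>s - 2 * e\<close> then tells which \<open>i\<close> belong to \<open>I\<close>.\<close>
    define code where "code I = map (\<lambda>m. {a \<in> A. R a (\<beta>' I m)}) [0..<K]" for I
    have "inj_on code (Pow {..<N})"
    proof (rule inj_onI)
      fix I I' assume I: "I \<in> Pow {..<N}" "I' \<in> Pow {..<N}" and eq: "code I = code I'"
      have "R a (\<beta>' I m) = R a (\<beta>' I' m)" if "a \<in> A" "m < K" for a m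
      proof -
        have "code I ! m = code I' ! m" using eq by simp
        then show ?thesis using that by (auto simp: code_def)
      qed
      then have hh: "h I a = h I' a" if "a \<in> A" for a using that by (simp add: h_def)
      have eqs: "(\<Sum>m<k. h I (\<alpha> i (p i m))) = (\<Sum>m<k. h I' (\<alpha> i (p i m)))" if "i < N" for i
        using that by (intro sum.cong refl hh) (auto simp: A_def)
      show "I = I'"
      proof (rule ccontr)
        assume "I \<noteq> I'"
        then obtain i where i: "i < N" "(i \<in> I \<and> i \<notin> I') \<or> (i \<notin> I \<and> i \<in> I')" using I by blast
        then show False
          using p(2,3)[OF i(1), of I] p(2,3)[OF i(1), of I'] I eqs[OF i(1)] e(3) by auto
      qed
    qed
    moreover have "code ` Pow {..<N} \<subseteq> {xs. set xs \<subseteq> F \<and> length xs = K}"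
      using q(1) \<beta> by (auto simp: code_def F_def \<beta>'_def)
    ultimately have "card (Pow {..<N}) \<le> card {xs. set xs \<subseteq> F \<and> length xs = K}"
      using finite_lists_length_eq[OF finF] by (metis card_image card_mono)
    then have "2 ^ N \<le> card F ^ K" by (simp add: card_Pow card_lists_length_eq[OF finF])
    also have "\<dots> \<le> ((N * k + 1) ^ d) ^ K"
      using cF cA by (intro power_mono) (auto intro: order_trans power_mono)
    finally show False using lt by (simp add: power_mult)
  qed
  show ?thesis
  proof (intro exI[of _ N] allI impI, rule ccontr)
    fix n :: "nat \<Rightarrow> nat" and \<alpha> and t :: "nat set \<Rightarrow> nat" and \<beta>
    assume n: "\<forall>i<N. 0 < n i \<and> (\<forall>l<n i. \<alpha> i l \<in> X)"
      and t: "\<forall>I\<subseteq>{..<N}. 0 < t I \<and> (\<forall>j<t I. \<beta> I j \<in> Y)"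
      and neg: "\<not> (\<exists>I\<subseteq>{..<N}. \<exists>i<N. if i \<in> I
        then r < (\<Sum>j<t I. (\<Sum>l<n i. of_bool (R (\<alpha> i l) (\<beta> I j))) / real (n i)) / real (t I)
        else (\<Sum>j<t I. (\<Sum>l<n i. of_bool (R (\<alpha> i l) (\<beta> I j))) / real (n i)) / real (t I) < s)"
    have *: "\<not> (if i \<in> I
        then r < (\<Sum>j<t I. (\<Sum>l<n i. of_bool (R (\<alpha> i l) (\<beta> I j))) / real (n i)) / real (t I)
        else (\<Sum>j<t I. (\<Sum>l<n i. of_bool (R (\<alpha> i l) (\<beta> I j))) / real (n i)) / real (t I) < s)"
      if "I \<subseteq> {..<N}" "i < N" for I i
      using neg that by blast
    show False
    proof (rule contra[of n \<alpha> t \<beta>])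
      fix I i assume I: "I \<subseteq> {..<N}" "i < N"
      show "(\<Sum>j<t I. (\<Sum>l<n i. of_bool (R (\<alpha> i l) (\<beta> I j))) / real (n i)) / real (t I) \<le> r"
        if "i \<in> I" using *[OF I] that by (simp only: if_True not_less)
      show "s \<le> (\<Sum>j<t I. (\<Sum>l<n i. of_bool (R (\<alpha> i l) (\<beta> I j))) / real (n i)) / real (t I)"
        if "i \<notin> I" using *[OF I] that by (simp only: if_False not_less)
    qed (use n t in blast)+
  qed
qed


section \<open>Skolem hulls and ultrapowers\<close>

lemma eval_cong:
  "(\<And>v. v \<in> fv_tm t \<Longrightarrow> e v = e' v) \<Longrightarrow> eval M e t = eval M e' t"
proof (induction t)
  case (App f ts)
  then have "map (eval M e) ts = map (eval M e') ts" by (intro map_cong) auto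
  then show ?case by (simp del: map_eq_conv)
qed simp

lemma sat_cong:
  "(\<And>v. v \<in> fv \<phi> \<Longrightarrow> e v = e' v) \<Longrightarrow> sat M e \<phi> \<longleftrightarrow> sat M e' \<phi>"
proof (induction \<phi> arbitrary: e e')
  case (Eq s t)
  then show ?case using eval_cong[of s e e' M] eval_cong[of t e e' M] by simp
next
  case (Rel p ts)
  then have "map (eval M e) ts = map (eval M e') ts" by (intro map_cong eval_cong) auto
  then show ?case by (simp del: map_eq_conv)
next
  case (Neg \<phi>)
  have "sat M e \<phi> = sat M e' \<phi>" by (rule Neg.IH) (use Neg.prems in simp)
  then show ?case by simp
next
  case (Conj \<phi> \<psi>)
  have "sat M e \<phi> = sat M e' \<phi>" "sat M e \<psi> = sat M e' \<psi>"
    by (rule Conj.IH; use Conj.prems in simp)+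
  then show ?case by simp
next
  case (Ex v \<phi>)
  have "sat M (e(v := m)) \<phi> = sat M (e'(v := m)) \<phi>" for m
    by (rule Ex.IH) (use Ex.prems in auto)
  then show ?case by simp
qed

lemma finite_fv_tm: "finite (fv_tm t)"
  by (induction t) auto

lemma finite_fv: "finite (fv \<phi>)"
  by (induction \<phi>) (auto simp: finite_fv_tm)

lemma eval_univ_update: "eval (M\<lparr>univ := H\<rparr>) e t = eval M e t"
proof (induction t)
  case (App f ts)
  then have "map (eval (M\<lparr>univ := H\<rparr>) e) ts = map (eval M e) ts" by (intro map_cong) auto
  then show ?case by (simp del: map_eq_conv)
qed simp

section \<open>Skolem hulls and elementary substructures\<close>

definition skolem_witness ::
  "('f, 'p, 'm) struct \<Rightarrow> 'm \<Rightarrow> nat \<Rightarrow> ('f, 'p) fm \<Rightarrow> (nat \<Rightarrow> 'm) \<Rightarrow> 'm" where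
  "skolem_witness M m0 v \<phi> e =
     (if \<exists>m\<in>univ M. sat M (e(v := m)) \<phi> then SOME m. m \<in> univ M \<and> sat M (e(v := m)) \<phi> else m0)"

text \<open>The Skolem hull of a sequence \<open>c\<close> is enumerated by formulas, which serve as codes:
  \<open>Ex n \<psi>\<close> stands for \<open>c n\<close>, and \<open>Conj (Ex v \<phi>) \<psi>\<close> for a witness of \<open>\<exists>v. \<phi>\<close> under the assignment
  whose values are coded by the conjuncts of \<open>\<psi>\<close>. Thus the hull has at most as many elements as
  there are formulas.\<close>

fun hull_val :: "('f, 'p, 'm) struct \<Rightarrow> (nat \<Rightarrow> 'm) \<Rightarrow> ('f, 'p) fm \<Rightarrow> 'm"
  and hull_env :: "('f, 'p, 'm) struct \<Rightarrow> (nat \<Rightarrow> 'm) \<Rightarrow> ('f, 'p) fm \<Rightarrow> nat \<Rightarrow> 'm" where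
  "hull_val M c (Conj (Ex v \<phi>) \<psi>) = skolem_witness M (c 0) v \<phi> (hull_env M c \<psi>)"
| "hull_val M c (Ex n \<psi>) = c n"
| "hull_val M c _ = c 0"
| "hull_env M c (Conj \<phi> \<psi>) = case_nat (hull_val M c \<phi>) (hull_env M c \<psi>)"
| "hull_env M c _ = (\<lambda>_. c 0)"

lemma skolem_witness_in_univ:
  assumes "m0 \<in> univ M"
  shows "skolem_witness M m0 v \<phi> e \<in> univ M"
proof (cases "\<exists>m. m \<in> univ M \<and> sat M (e(v := m)) \<phi>")
  case True
  from someI_ex[OF this] True show ?thesis unfolding skolem_witness_def Bex_def by (simp only: if_True)
next
  case False
  then show ?thesis unfolding skolem_witness_def Bex_def by (simp only: if_False assms)
qed

lemma skolem_witness_sat: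
  assumes "m \<in> univ M" "sat M (e(v := m)) \<phi>"
  shows "sat M (e(v := skolem_witness M m0 v \<phi> e)) \<phi>"
proof -
  have "\<exists>m. m \<in> univ M \<and> sat M (e(v := m)) \<phi>" using assms by blast
  from someI_ex[OF this] show ?thesis using assms by (auto simp: skolem_witness_def)
qed

lemma hull_val_in_univ:
  assumes "range c \<subseteq> univ M"
  shows "hull_val M c \<phi> \<in> univ M"
proof -
  have c: "c n \<in> univ M" for n using assms by blast
  show ?thesis
  proof (cases \<phi>)
    case (Conj \<theta> \<psi>)
    then show ?thesis by (cases \<theta>) (simp_all add: c skolem_witness_in_univ)
  qed (simp_all add: c)
qed

text \<open>A code carries finitely many values, so agreement is asked only below \<open>k\<close>;
  this is enough because a formula has finitely many free variables.\<close>

lemma hull_env_surj: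
  assumes "range e \<subseteq> range (hull_val M c)"
  shows "\<exists>\<psi>. \<forall>w<k. hull_env M c \<psi> w = e w"
  using assms
proof (induction k arbitrary: e)
  case (Suc k)
  have "range (\<lambda>n. e (Suc n)) \<subseteq> range (hull_val M c)" using Suc.prems by auto
  from Suc.IH[OF this] obtain \<psi> where \<psi>: "\<forall>w<k. hull_env M c \<psi> w = e (Suc w)" by blast
  obtain \<theta> where "e 0 = hull_val M c \<theta>" using Suc.prems by blast
  then have "\<forall>w<Suc k. hull_env M c (Conj \<theta> \<psi>) w = e w"
    using \<psi> by (auto simp: less_Suc_eq_0_disj)
  then show ?case by blast
qed simp

text \<open>The Tarski-Vaught argument: an existential formula true in \<open>M\<close> under an
  assignment into the hull has a witness in the hull.\<close>

lemma sat_hull: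
  fixes M :: "('f, 'p, 'm) struct"
  assumes c: "range c \<subseteq> univ M" and e: "range e \<subseteq> range (hull_val M c)"
  shows "sat (M\<lparr>univ := range (hull_val M c)\<rparr>) e \<phi> \<longleftrightarrow> sat M e \<phi>"
  using e
proof (induction \<phi> arbitrary: e)
  case (Eq s t)
  then show ?case by (simp add: eval_univ_update)
next
  case (Rel p ts)
  have "map (eval (M\<lparr>univ := range (hull_val M c)\<rparr>) e) ts = map (eval M e) ts"
    by (simp add: eval_univ_update)
  then show ?case by (simp del: map_eq_conv)
next
  case (Ex v \<phi>)
  let ?H = "range (hull_val M c)"
  have IH: "sat (M\<lparr>univ := ?H\<rparr>) (e(v := m)) \<phi> = sat M (e(v := m)) \<phi>" if "m \<in> ?H" for m
    using Ex that by (intro Ex.IH) (auto simp: fun_upd_def)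
  show ?case
  proof
    assume "sat (M\<lparr>univ := ?H\<rparr>) e (Ex v \<phi>)"
    then obtain m where "m \<in> ?H" "sat M (e(v := m)) \<phi>" using IH by auto
    then show "sat M e (Ex v \<phi>)" using hull_val_in_univ[OF c] by auto
  next
    assume "sat M e (Ex v \<phi>)"
    then obtain m where m: "m \<in> univ M" "sat M (e(v := m)) \<phi>" by auto
    obtain k where k: "\<And>w. w \<in> fv \<phi> \<Longrightarrow> w < k"
      using finite_nat_set_iff_bounded finite_fv by metis
    \<comment> \<open>The coded environment agrees with \<open>e\<close> on the free variables of
      \<open>\<phi>\<close>, so the Skolem witness for the code also works for
      \<open>e\<close>.\<close>
    obtain \<psi> where \<psi>: "\<forall>w<k. hull_env M c \<psi> w = e w" using hull_env_surj[OF Ex.prems] by blast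
    have agree: "sat M ((hull_env M c \<psi>)(v := m')) \<phi> = sat M (e(v := m')) \<phi>" for m'
      using \<psi> k by (intro sat_cong) auto
    have "sat M (e(v := hull_val M c (Conj (Ex v \<phi>) \<psi>))) \<phi>"
      using skolem_witness_sat[of m M "hull_env M c \<psi>" v \<phi> "c 0"] m agree by simp
    then show "sat (M\<lparr>univ := ?H\<rparr>) e (Ex v \<phi>)" using IH by (metis rangeI sat.simps(5) select_convs(1) surjective update_convs(1))
  qed
qed simp_all

text \<open>The conclusion keeps the enumeration \<open>h\<close> by formulas, since it allows
  sequences in the substructure to be coded later as sets of formulas.\<close>

lemma downward_Loewenheim_Skolem:
  fixes M :: "('f, 'p, 'm) struct" and c :: "nat \<Rightarrow> 'm"
  assumes M: "is_structure L M" and c: "range c \<subseteq> univ M"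
  obtains h :: "('f, 'p) fm \<Rightarrow> 'm" where "range c \<subseteq> range h"
    "is_structure L (M\<lparr>univ := range h\<rparr>)"
    "\<And>e \<phi>. range e \<subseteq> range h \<Longrightarrow> sat (M\<lparr>univ := range h\<rparr>) e \<phi> \<longleftrightarrow> sat M e \<phi>"
    "range h \<subseteq> univ M"
proof (rule that[of "hull_val M c"])
  let ?H = "range (hull_val M c)"
  have cH: "c n \<in> ?H" for n
    using rangeI[of "hull_val M c" "Ex n undefined"] by simp
  then show "range c \<subseteq> ?H" by blast
  show "?H \<subseteq> univ M" using hull_val_in_univ[OF c] by blast
  show sat: "sat (M\<lparr>univ := ?H\<rparr>) e \<phi> \<longleftrightarrow> sat M e \<phi>" if "range e \<subseteq> ?H" for e \<phi>
    using sat_hull[OF c that] .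
  have "fun_of M f as \<in> ?H" if f: "(f, n) \<in> funs L" and as: "length as = n" "set as \<subseteq> ?H" for f n as
  proof -
    \<comment> \<open>Variables below \<open>n\<close> hold the arguments and variable
      \<open>n\<close> is left for the bound witness. The value of \<open>f\<close> is the only
      witness of \<open>\<exists>v_n. v_n = f(v_0, ..., v_(n-1))\<close>, so elementarity puts it
      into the hull.\<close>
    define e where "e w = (if w < n then as ! w else c 0)" for w
    have e: "range e \<subseteq> ?H" using as cH by (auto simp: e_def)
    have map: "map (\<lambda>w. (e(n := m)) w) [0..<n] = as" for m
      using as(1) by (intro nth_equalityI) (auto simp: e_def)
    have "fun_of M f as \<in> univ M"
      using M f as hull_val_in_univ[OF c] unfolding is_structure_def tuples_def by fastforce
    moreover have *: "sat M' e (Ex n (Eq (Var n) (App f (map Var [0..<n])))) \<longleftrightarrow> (\<exists>m\<in>univ M'. m = fun_of M' f as)"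
      for M' :: "('f, 'p, 'm) struct"
      using map by (simp add: comp_def)
    ultimately have "sat M e (Ex n (Eq (Var n) (App f (map Var [0..<n]))))" by blast
    then have "sat (M\<lparr>univ := ?H\<rparr>) e (Ex n (Eq (Var n) (App f (map Var [0..<n]))))"
      using sat[OF e] by blast
    then show ?thesis unfolding * by simp
  qed
  then show "is_structure L (M\<lparr>univ := ?H\<rparr>)" by (auto simp: is_structure_def tuples_def)
qed

section \<open>Ultrafilters, ultrapowers and the theorem of Los\<close>

text \<open>A smaller filter makes more predicates eventually true, so an ultrafilter is a minimal
  proper filter. Zorn's lemma is applied to the reversed order.\<close>

lemma ultrafilter_below:
  fixes F :: "'a filter"
  assumes "F \<noteq> bot"
  obtains U where "U \<le> F" "U \<noteq> bot" "\<And>P. eventually P U \<or> eventually (\<lambda>x. \<not> P x) U"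
proof -
  define A where "A = {G. G \<le> F \<and> G \<noteq> bot}"
  have "\<exists>U\<in>A. \<forall>G\<in>A. U \<ge> G \<longrightarrow> G = U"
  proof (rule predicate_Zorn)
    show "partial_order_on A (relation_of (\<ge>) A)"
      by (rule partial_order_on_relation_ofI) auto
    fix C assume C: "C \<in> Chains (relation_of (\<ge>) A)"
    have CA: "C \<subseteq> A" using Chains_relation_of[OF C] .
    have tot: "G \<le> G' \<or> G' \<le> G" if "G \<in> C" "G' \<in> C" for G G'
      using C that unfolding Chains_def relation_of_def by blast
    show "\<exists>U\<in>A. \<forall>G\<in>C. U \<le> G"
    proof (cases "C = {}")
      case True
      then show ?thesis using assms by (auto simp: A_def)
    next
      case False
      \<comment> \<open>In a chain, a predicate is eventually true for the infimum only if it is so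
        for some member; hence the infimum stays proper.\<close>
      have ev: "eventually P (Inf C) \<longleftrightarrow> (\<exists>G\<in>C. eventually P G)" for P
        using tot by (intro eventually_Inf_base[OF False]) (metis inf.absorb1 inf.absorb2 order_refl)
      have "Inf C \<noteq> bot" using ev[of "\<lambda>_. False"] CA by (auto simp: A_def trivial_limit_def)
      moreover have "Inf C \<le> F" using False CA by (auto simp: A_def intro: Inf_lower2)
      ultimately have "Inf C \<in> A" by (simp add: A_def)
      then show ?thesis by (auto intro: Inf_lower)
    qed
  qed
  then obtain U where U: "U \<le> F" "U \<noteq> bot" and min: "\<And>G. G \<le> U \<Longrightarrow> G \<noteq> bot \<Longrightarrow> G = U"
    unfolding A_def by (blast intro: order_trans)
  have "eventually P U \<or> eventually (\<lambda>x. \<not> P x) U" for P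
  \<comment> \<open>Either \<open>P\<close> is incompatible with \<open>U\<close>, so its negation
    holds eventually, or by minimality the meet equals \<open>U\<close> and \<open>P\<close> holds
    eventually.\<close>
  proof (cases "inf U (principal {x. P x}) = bot")
    case True
    then have "eventually (\<lambda>_. False) (inf U (principal {x. P x}))" by simp
    then show ?thesis by (simp add: eventually_inf_principal)
  next
    case False
    then have "U \<le> principal {x. P x}" using min[of "inf U (principal {x. P x})"] by (metis inf_le1 inf_le2)
    then show ?thesis by (simp add: le_principal)
  qed
  with U that show thesis by blast
qed

text \<open>An ultrapower whose elements are coded by a map \<open>K\<close> that identifies exactly the sequences
  equal \<open>U\<close>-almost everywhere. The target type of \<open>K\<close> is arbitrary, which allows the ultrapower to
  live in a prescribed type.\<close>

locale ultrapower =
  fixes L :: "('f, 'p) lang" and M :: "('f, 'p, 'm) struct" and U :: "nat filter"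
    and K :: "(nat \<Rightarrow> 'm) \<Rightarrow> 'b"
  assumes struct: "is_structure L M"
    and ultra: "\<And>P. eventually P U \<or> eventually (\<lambda>n. \<not> P n) U" and nontriv: "U \<noteq> bot"
    and K_eq: "\<And>g g'. range g \<subseteq> univ M \<Longrightarrow> range g' \<subseteq> univ M \<Longrightarrow>
      K g = K g' \<longleftrightarrow> eventually (\<lambda>n. g n = g' n) U"
begin

definition seqs :: "(nat \<Rightarrow> 'm) set" where "seqs = {g. range g \<subseteq> univ M}"

text \<open>\<open>D X\<close> is a representative sequence of the class coded by \<open>X\<close>;
  the structure \<open>N\<close> is computed coordinatewise on representatives.\<close>

definition D :: "'b \<Rightarrow> nat \<Rightarrow> 'm" where "D = inv_into seqs K"

definition N :: "('f, 'p, 'b) struct" where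
  "N = \<lparr>univ = K ` seqs, fun_of = \<lambda>f Xs. K (\<lambda>n. fun_of M f (map (\<lambda>X. D X n) Xs)),
     rel_of = \<lambda>p Xs. eventually (\<lambda>n. rel_of M p (map (\<lambda>X. D X n) Xs)) U\<rparr>"

lemma eventually_not_iff: "eventually (\<lambda>n. \<not> P n) U \<longleftrightarrow> \<not> eventually P U"
proof
  assume "eventually (\<lambda>n. \<not> P n) U"
  then show "\<not> eventually P U"
    using eventually_conj[of P U "\<lambda>n. \<not> P n"] nontriv by (auto simp: trivial_limit_def)
qed (use ultra[of P] in blast)

lemma D_in: "X \<in> univ N \<Longrightarrow> D X n \<in> univ M"
proof -
  assume "X \<in> univ N"
  then have "D X \<in> seqs" unfolding D_def by (intro inv_into_into) (simp add: N_def)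
  then show "D X n \<in> univ M" by (auto simp: seqs_def)
qed

lemma K_D: "X \<in> univ N \<Longrightarrow> K (D X) = X"
  unfolding D_def by (simp add: N_def f_inv_into_f)

lemma K_in: "range g \<subseteq> univ M \<Longrightarrow> K g \<in> univ N"
  by (auto simp: N_def seqs_def)

lemma D_K: "range g \<subseteq> univ M \<Longrightarrow> eventually (\<lambda>n. D (K g) n = g n) U"
  using K_D[OF K_in] K_eq[of "D (K g)" g] D_in[OF K_in] by blast

lemma eq_iff_eventually:
  assumes "X \<in> univ N" "X' \<in> univ N"
  shows "X = X' \<longleftrightarrow> eventually (\<lambda>n. D X n = D X' n) U"
  using K_eq[of "D X" "D X'"] assms by (auto simp: K_D D_in image_subset_iff)

lemma fun_of_in:
  assumes "(f, length as) \<in> funs L" "set as \<subseteq> univ M"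
  shows "fun_of M f as \<in> univ M"
  using struct assms unfolding is_structure_def tuples_def by fastforce

lemma fun_of_range:
  assumes "(f, length Xs) \<in> funs L" "set Xs \<subseteq> univ N"
  shows "range (\<lambda>n. fun_of M f (map (\<lambda>X. D X n) Xs)) \<subseteq> univ M"
  using assms by (auto intro!: fun_of_in D_in)

lemma is_structure_N: "is_structure L N"
proof -
  have "fun_of N f Xs \<in> univ N" if "(f, length Xs) \<in> funs L" "set Xs \<subseteq> univ N" for f Xs
    using K_in[OF fun_of_range[OF that]] by (simp add: N_def)
  moreover have "univ N \<noteq> {}"
  proof -
    obtain m where "m \<in> univ M" using struct by (auto simp: is_structure_def)
    then show ?thesis using K_in[of "\<lambda>_. m"] by auto
  qed
  ultimately show ?thesis by (auto simp: is_structure_def tuples_def)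
qed

lemma eval_N:
  assumes e: "range e \<subseteq> univ N"
  shows "wf_tm L t \<Longrightarrow> eval N e t \<in> univ N \<and>
    eventually (\<lambda>n. D (eval N e t) n = eval M (\<lambda>v. D (e v) n) t) U"
proof (induction t)
  case (Var v)
  then show ?case using e by auto
next
  case (App f ts)
  let ?Xs = "map (eval N e) ts"
  have in_N: "set ?Xs \<subseteq> univ N" and
    ev: "\<forall>t\<in>set ts. eventually (\<lambda>n. D (eval N e t) n = eval M (\<lambda>v. D (e v) n) t) U"
    using App by auto
  define G where "G n = fun_of M f (map (\<lambda>X. D X n) ?Xs)" for n
  have G: "range G \<subseteq> univ M" unfolding G_def using App.prems in_N by (intro fun_of_range) auto
  have eq: "eval N e (App f ts) = K G" by (simp add: N_def G_def[abs_def])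
  have "eventually (\<lambda>n. D (K G) n = eval M (\<lambda>v. D (e v) n) (App f ts)) U"
    using D_K[OF G] eventually_ball_finite[OF finite_set ev]
  proof eventually_elim
    case (elim n)
    then have "map (\<lambda>X. D X n) ?Xs = map (eval M (\<lambda>v. D (e v) n)) ts" by simp
    then show ?case using elim(1) unfolding G_def by (simp only: eval.simps)
  qed
  then show ?case using K_in[OF G] unfolding eq by blast
qed

text \<open>Negation is where \<open>U\<close> has to be a proper ultrafilter. In the existential
  case, coordinatewise witnesses are collected into one sequence, whose class is the witness in
  \<open>N\<close>.\<close>

lemma Los:
  assumes "range e \<subseteq> univ N" "wf_fm L \<phi>"
  shows "sat N e \<phi> \<longleftrightarrow> eventually (\<lambda>n. sat M (\<lambda>v. D (e v) n) \<phi>) U"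
  using assms
proof (induction \<phi> arbitrary: e)
  case (Eq s t)
  then have s: "eval N e s \<in> univ N" "eventually (\<lambda>n. D (eval N e s) n = eval M (\<lambda>v. D (e v) n) s) U"
    and t: "eval N e t \<in> univ N" "eventually (\<lambda>n. D (eval N e t) n = eval M (\<lambda>v. D (e v) n) t) U"
    using eval_N by auto
  have "eventually (\<lambda>n. (D (eval N e s) n = D (eval N e t) n) =
    (eval M (\<lambda>v. D (e v) n) s = eval M (\<lambda>v. D (e v) n) t)) U"
    using s(2) t(2) by eventually_elim simp
  then show ?case using eq_iff_eventually[OF s(1) t(1)] by (simp add: eventually_subst)
next
  case (Rel p ts)
  have ev: "\<forall>t\<in>set ts. eventually (\<lambda>n. D (eval N e t) n = eval M (\<lambda>v. D (e v) n) t) U"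
    using Rel eval_N by auto
  have "eventually (\<lambda>n. rel_of M p (map (\<lambda>X. D X n) (map (eval N e) ts)) =
    rel_of M p (map (eval M (\<lambda>v. D (e v) n)) ts)) U"
    using eventually_ball_finite[OF finite_set ev]
  proof eventually_elim
    case (elim n)
    then have "map (\<lambda>X. D X n) (map (eval N e) ts) = map (eval M (\<lambda>v. D (e v) n)) ts" by simp
    then show ?case by (simp only:)
  qed
  from eventually_subst[OF this] show ?case by (simp add: N_def)
next
  case (Neg \<phi>)
  then show ?case by (simp add: eventually_not_iff)
next
  case (Conj \<phi> \<psi>)
  then show ?case by (simp add: eventually_conj_iff)
next
  case (Ex v \<phi>)
  have upd: "(\<lambda>w. D ((e(v := X)) w) n) = (\<lambda>w. D (e w) n)(v := D X n)" for X n by auto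
  have IH: "sat N (e(v := X)) \<phi> \<longleftrightarrow> eventually (\<lambda>n. sat M ((\<lambda>w. D (e w) n)(v := D X n)) \<phi>) U"
    if "X \<in> univ N" for X
    unfolding upd[symmetric] using Ex.prems that by (intro Ex.IH) (auto simp: fun_upd_def)
  show ?case
  proof
    assume "sat N e (Ex v \<phi>)"
    then obtain X where X: "X \<in> univ N" "eventually (\<lambda>n. sat M ((\<lambda>w. D (e w) n)(v := D X n)) \<phi>) U"
      using IH by auto
    from X(2) show "eventually (\<lambda>n. sat M (\<lambda>w. D (e w) n) (Ex v \<phi>)) U"
      by eventually_elim (use D_in[OF X(1)] in auto)
  next
    assume ev: "eventually (\<lambda>n. sat M (\<lambda>w. D (e w) n) (Ex v \<phi>)) U"
    obtain m0 where m0: "m0 \<in> univ M" using struct by (auto simp: is_structure_def)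
    \<comment> \<open>At the coordinates without a witness the default \<open>m0\<close> is
      taken.\<close>
    have "\<exists>m. m \<in> univ M \<and> (sat M (\<lambda>w. D (e w) n) (Ex v \<phi>) \<longrightarrow> sat M ((\<lambda>w. D (e w) n)(v := m)) \<phi>)" for n
      using m0 by auto
    then obtain g where g: "\<And>n. g n \<in> univ M"
      "\<And>n. sat M (\<lambda>w. D (e w) n) (Ex v \<phi>) \<Longrightarrow> sat M ((\<lambda>w. D (e w) n)(v := g n)) \<phi>" by metis
    have g': "range g \<subseteq> univ M" using g(1) by auto
    have "eventually (\<lambda>n. sat M ((\<lambda>w. D (e w) n)(v := D (K g) n)) \<phi>) U"
      using ev D_K[OF g'] by eventually_elim (use g(2) in simp)
    then have "sat N (e(v := K g)) \<phi>" using IH[OF K_in[OF g']] by blast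
    then show "sat N e (Ex v \<phi>)" using K_in[OF g'] by auto
  qed
qed

lemma is_model_N:
  assumes "is_model L T M" and "T \<subseteq> sentences L"
  shows "is_model L T N"
proof -
  have "sat N e \<sigma>" if \<sigma>: "\<sigma> \<in> T" and e: "range e \<subseteq> univ N" for \<sigma> e
  proof -
    have "sat M (\<lambda>v. D (e v) n) \<sigma>" for n
    proof -
      have "range (\<lambda>v. D (e v) n) \<subseteq> univ M" using e by (auto intro!: D_in)
      then show ?thesis using assms(1) \<sigma> by (simp add: is_model_def holds_def)
    qed
    then show ?thesis using Los[OF e, of \<sigma>] assms(2) \<sigma> by (auto simp: sentences_def)
  qed
  then show ?thesis using is_structure_N by (auto simp: is_model_def holds_def)
qed

definition lift_tuple :: "nat \<Rightarrow> (nat \<Rightarrow> 'm list) \<Rightarrow> 'b list" where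
  "lift_tuple k \<alpha> = map (\<lambda>l. K (\<lambda>n. \<alpha> n ! l)) [0..<k]"

end

text \<open>Unlike the assignment in \<open>sat_at\<close>, the following one takes its values in the structure.\<close>

lemma sat_at_eq:
  assumes "partitioned L \<phi> x y" "length a = length x" "length b = length y"
  shows "sat_at M \<phi> x y a b \<longleftrightarrow>
    sat M (\<lambda>v. case map_of (zip (x @ y) (a @ b)) v of None \<Rightarrow> m | Some z \<Rightarrow> z) \<phi>"
  unfolding sat_at_def
proof (rule sat_cong)
  fix v assume "v \<in> fv \<phi>"
  then have "v \<in> set (x @ y)" using assms(1) by (auto simp: partitioned_def)
  moreover have "length (x @ y) = length (a @ b)" using assms(2,3) by simp
  ultimately obtain z where "map_of (zip (x @ y) (a @ b)) v = Some z"
    using map_of_zip_is_Some[of "x @ y" "a @ b" v] by blast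
  then show "the (map_of (zip (x @ y) (a @ b)) v) =
    (case map_of (zip (x @ y) (a @ b)) v of None \<Rightarrow> m | Some z \<Rightarrow> z)" by simp
qed

lemma assignment_range:
  assumes "set a \<subseteq> H" "set b \<subseteq> H" "m \<in> H"
  shows "range (\<lambda>v. case map_of (zip (x @ y) (a @ b)) v of None \<Rightarrow> m | Some z \<Rightarrow> z) \<subseteq> H"
proof -
  have "z \<in> H" if "map_of (zip (x @ y) (a @ b)) v = Some z" for v z
    using map_of_SomeD[OF that] assms by (auto dest!: set_zip_rightD)
  then show ?thesis using assms(3) by (auto split: option.split)
qed

context ultrapower
begin

lemma lift_tuple_in:
  assumes "\<And>n. \<alpha> n \<in> tuples M k"
  shows "lift_tuple k \<alpha> \<in> tuples N k"
proof -
  have "\<alpha> n ! l \<in> univ M" if "l < k" for n l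
    using assms[of n] nth_mem[of l "\<alpha> n"] that by (auto simp: tuples_def)
  then show ?thesis by (auto simp: lift_tuple_def tuples_def intro!: K_in)
qed

lemma Los_sat_at:
  assumes \<phi>: "partitioned L \<phi> x y"
    and \<alpha>: "\<And>n. \<alpha> n \<in> tuples M (length x)" and \<beta>: "\<And>n. \<beta> n \<in> tuples M (length y)"
  shows "sat_at N \<phi> x y (lift_tuple (length x) \<alpha>) (lift_tuple (length y) \<beta>) \<longleftrightarrow>
    eventually (\<lambda>n. sat_at M \<phi> x y (\<alpha> n) (\<beta> n)) U"
proof -
  obtain m where m: "m \<in> univ M" using struct by (auto simp: is_structure_def)
  \<comment> \<open>Los's theorem requires an assignment with all values in \<open>N\<close>, so
    variables outside \<open>x @ y\<close> get the class of a constant sequence.\<close>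
  define X0 where "X0 = K (\<lambda>_. m)"
  have X0: "X0 \<in> univ N" unfolding X0_def using m by (intro K_in) auto
  let ?a = "lift_tuple (length x) \<alpha>" and ?b = "lift_tuple (length y) \<beta>"
  have len: "length (\<alpha> n) = length x" "length (\<beta> n) = length y" for n
    using \<alpha>[of n] \<beta>[of n] by (auto simp: tuples_def)
  have ab: "?a \<in> tuples N (length x)" "?b \<in> tuples N (length y)"
    using lift_tuple_in \<alpha> \<beta> by auto
  define e where "e v = (case map_of (zip (x @ y) (?a @ ?b)) v of None \<Rightarrow> X0 | Some z \<Rightarrow> z)" for v
  have e: "range e \<subseteq> univ N"
    unfolding e_def using ab X0 by (intro assignment_range) (auto simp: tuples_def)
  have "sat_at N \<phi> x y ?a ?b \<longleftrightarrow> sat N e \<phi>"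
    unfolding e_def using ab by (intro sat_at_eq[OF \<phi>]) (auto simp: tuples_def)
  also have "\<dots> \<longleftrightarrow> eventually (\<lambda>n. sat M (\<lambda>v. D (e v) n) \<phi>) U"
    using \<phi> by (intro Los[OF e]) (simp add: partitioned_def)
  also have "\<dots> \<longleftrightarrow> eventually (\<lambda>n. sat_at M \<phi> x y (\<alpha> n) (\<beta> n)) U"
  proof (rule eventually_subst)
    \<comment> \<open>Almost everywhere agreement at each of finitely many variables gives almost
      everywhere agreement at all of them.\<close>
    have "\<forall>v\<in>fv \<phi>. eventually (\<lambda>n. D (e v) n = the (map_of (zip (x @ y) (\<alpha> n @ \<beta> n)) v)) U"
    proof
      fix v assume "v \<in> fv \<phi>"
      then have "v \<in> set (x @ y)" using \<phi> by (auto simp: partitioned_def)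
      then obtain l where l: "l < length (x @ y)" "v = (x @ y) ! l" by (metis in_set_conv_nth)
      have dist: "distinct (x @ y)" using \<phi> by (simp add: partitioned_def)
      have "map_of (zip (x @ y) (?a @ ?b)) v = Some ((?a @ ?b) ! l)"
        unfolding l(2) using dist l(1) by (intro map_of_zip_nth) (auto simp: lift_tuple_def)
      moreover have "(?a @ ?b) ! l = K (\<lambda>n. (\<alpha> n @ \<beta> n) ! l)"
        using l(1) by (auto simp: nth_append lift_tuple_def len)
      ultimately have ev: "e v = K (\<lambda>n. (\<alpha> n @ \<beta> n) ! l)" by (simp add: e_def)
      have M: "map_of (zip (x @ y) (\<alpha> n @ \<beta> n)) v = Some ((\<alpha> n @ \<beta> n) ! l)" for n
        unfolding l(2) using dist l(1) by (intro map_of_zip_nth) (auto simp: len)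
      have "(\<alpha> n @ \<beta> n) ! l \<in> univ M" for n
      proof -
        have "(\<alpha> n @ \<beta> n) ! l \<in> set (\<alpha> n @ \<beta> n)" using l(1) by (intro nth_mem) (simp add: len)
        then show ?thesis using \<alpha>[of n] \<beta>[of n] by (auto simp: tuples_def)
      qed
      then show "eventually (\<lambda>n. D (e v) n = the (map_of (zip (x @ y) (\<alpha> n @ \<beta> n)) v)) U"
        unfolding ev M option.sel by (intro D_K) auto
    qed
    from eventually_ball_finite[OF finite_fv this]
    show "eventually (\<lambda>n. sat M (\<lambda>v. D (e v) n) \<phi> = sat_at M \<phi> x y (\<alpha> n) (\<beta> n)) U"
      unfolding sat_at_def by eventually_elim (rule sat_cong, simp)
  qed
  finally show ?thesis .
qed

end

text \<open>A sequence of formulas is coded by its graph, a set of formulas.\<close>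

lemma sequence_classes_code:
  fixes h :: "('f, 'p) fm \<Rightarrow> 'm" and U :: "nat filter"
  shows "\<exists>K :: (nat \<Rightarrow> 'm) \<Rightarrow> ('f, 'p) fm set. \<forall>g g'. range g \<subseteq> range h \<longrightarrow> range g' \<subseteq> range h \<longrightarrow>
      (K g = K g' \<longleftrightarrow> eventually (\<lambda>n. g n = g' n) U)"
proof -
  define num :: "nat \<Rightarrow> ('f, 'p) fm" where "num n = Ex n (Eq (Var 0) (Var 0))" for n
  \<comment> \<open>The choice depends only on the almost everywhere class of \<open>g\<close>, so
    equivalent sequences get the same graph. In that graph \<open>num n\<close> marks the position
    of an entry, so the graph determines the representative.\<close>
  define rep where "rep g = (SOME g'. range g' \<subseteq> range h \<and> eventually (\<lambda>n. g' n = g n) U)" for g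
  define K where "K g = range (\<lambda>n. Conj (num n) (inv h (rep g n)))" for g
  have rep: "range (rep g) \<subseteq> range h \<and> eventually (\<lambda>n. rep g n = g n) U" if "range g \<subseteq> range h" for g
    unfolding rep_def by (rule someI[of _ g]) (use that in simp)
  show ?thesis
  proof (intro exI[of _ K] allI impI)
    fix g g' :: "nat \<Rightarrow> 'm" assume g: "range g \<subseteq> range h" "range g' \<subseteq> range h"
    show "K g = K g' \<longleftrightarrow> eventually (\<lambda>n. g n = g' n) U"
    proof
      assume K: "K g = K g'"
      have "rep g n = rep g' n" for n
      proof -
        have "Conj (num n) (inv h (rep g n)) \<in> K g'" 
          unfolding K[symmetric] unfolding K_def by (rule rangeI)
        then have "inv h (rep g n) = inv h (rep g' n)" by (auto simp: K_def num_def)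
        then show ?thesis using rep[OF g(1)] rep[OF g(2)] by (metis (no_types) f_inv_into_f range_subsetD)
      qed
      then have "eventually (\<lambda>n. rep g n = g' n) U" using rep[OF g(2)] by simp
      with conjunct2[OF rep[OF g(1)]] show "eventually (\<lambda>n. g n = g' n) U"
        by eventually_elim simp
    next
      assume ev: "eventually (\<lambda>n. g n = g' n) U"
      have "eventually (\<lambda>n. k n = g n) U \<longleftrightarrow> eventually (\<lambda>n. k n = g' n) U" for k
        by (rule eventually_subst) (use ev in eventually_elim, simp)
      then show "K g = K g'" by (simp add: K_def rep_def)
    qed
  qed
qed

section \<open>Finite VC dimension from NIP\<close>

text \<open>\<open>M\<close> may live in any type, whereas \<open>NIP\<close> speaks of models made
  of sets of formulas. The hull is enumerated by formulas and its ultrapower is coded by sets of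
  formulas, so the failure is moved into a model to which \<open>NIP\<close> applies.\<close>

lemma NIP_finite_VC_dimension:
  fixes M :: "('f, 'p, 'm) struct"
  assumes nip: "NIP L T" and T: "T \<subseteq> sentences L" and M: "is_model L T M"
    and \<phi>: "partitioned L \<phi> x y"
  shows "\<exists>d. \<forall>B. finite B \<longrightarrow> B \<subseteq> tuples M (length x) \<longrightarrow>
    (\<forall>C\<subseteq>B. \<exists>b\<in>tuples M (length y). \<forall>a\<in>B. sat_at M \<phi> x y a b \<longleftrightarrow> a \<in> C) \<longrightarrow> card B \<le> d"
proof (rule ccontr)
  define sh where "sh B \<longleftrightarrow>
    (\<forall>C\<subseteq>B. \<exists>b\<in>tuples M (length y). \<forall>a\<in>B. sat_at M \<phi> x y a b \<longleftrightarrow> a \<in> C)" for B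
  assume "\<not> ?thesis"
  then have big: "\<exists>B. finite B \<and> B \<subseteq> tuples M (length x) \<and> d < card B \<and> sh B" for d
    unfolding sh_def[symmetric] by (metis not_le)
  define wit where "wit d a b \<longleftrightarrow>
    (\<forall>i. a i \<in> tuples M (length x)) \<and> (\<forall>I. b I \<in> tuples M (length y)) \<and>
    (\<forall>i<d. \<forall>I\<subseteq>{..<d}. sat_at M \<phi> x y (a i) (b I) \<longleftrightarrow> i \<in> I)"
    for d :: nat and a :: "nat \<Rightarrow> 'm list" and b :: "nat set \<Rightarrow> 'm list"
  have "\<exists>a b. wit d a b" for d
  proof -
    obtain B where B: "finite B" "B \<subseteq> tuples M (length x)" "d < card B"
      "\<And>C. C \<subseteq> B \<Longrightarrow> \<exists>b\<in>tuples M (length y). \<forall>a\<in>B. sat_at M \<phi> x y a b \<longleftrightarrow> a \<in> C"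
      using big[of d] unfolding sh_def by (elim exE conjE) simp
    obtain a0 where a0: "bij_betw a0 {..<card B} B"
      using ex_bij_betw_nat_finite[OF B(1)] by (auto simp: atLeast0LessThan)
    \<comment> \<open>Indices from \<open>d\<close> on repeat the point \<open>a0 0\<close>, which
      lies in \<open>B\<close> because \<open>d < card B\<close>.\<close>
    define a where "a i = a0 (if i < d then i else 0)" for i
    have aB: "a i \<in> B" for i
      using a0 B(3) by (auto simp: a_def bij_betw_def)
    have inj: "inj_on a {..<d}"
      using a0 B(3) by (auto simp: a_def bij_betw_def inj_on_def)
    have "\<exists>b\<in>tuples M (length y). \<forall>a'\<in>B. sat_at M \<phi> x y a' b \<longleftrightarrow> a' \<in> a ` (I \<inter> {..<d})" for I
      using aB by (intro B(4)) auto
    then obtain b where b: "\<And>I. b I \<in> tuples M (length y)"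
      "\<And>I a'. a' \<in> B \<Longrightarrow> sat_at M \<phi> x y a' (b I) \<longleftrightarrow> a' \<in> a ` (I \<inter> {..<d})" by metis
    have "sat_at M \<phi> x y (a i) (b I) \<longleftrightarrow> i \<in> I" if "i < d" "I \<subseteq> {..<d}" for i I
      unfolding b(2)[OF aB] using inj that by (auto simp: inj_on_def)
    then show ?thesis using aB b(1) B(2) unfolding wit_def by blast
  qed
  then obtain a b where "\<And>d. wit d (a d) (b d)" by metis
  then have a: "a d i \<in> tuples M (length x)" and b: "b d I \<in> tuples M (length y)"
    and ab: "i < d \<Longrightarrow> I \<subseteq> {..<d} \<Longrightarrow> sat_at M \<phi> x y (a d i) (b d I) \<longleftrightarrow> i \<in> I" for d i I
    unfolding wit_def by auto
  have structM: "is_structure L M" using M by (simp add: is_model_def)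
  then obtain m where m: "m \<in> univ M" by (auto simp: is_structure_def)
  \<comment> \<open>For each \<open>d\<close> only the finitely many
    \<open>I \<subseteq> {..<d}\<close> are used, which keeps \<open>E\<close> countable. The
    element \<open>m\<close> later serves as the value of irrelevant variables.\<close>
  define E where "E = insert m ((\<Union>d. \<Union>i. set (a d i)) \<union> (\<Union>d. \<Union>I\<in>Pow {..<d}. set (b d I)))"
  have "countable E" unfolding E_def
    by (intro countable_insert countable_Un countable_UN countable_finite[of "set _"] countable_finite[of "Pow _"]) auto
  define c where "c = from_nat_into E"
  have rc: "range c = E"
    unfolding c_def using \<open>countable E\<close> by (intro range_from_nat_into) (auto simp: E_def)
  have "set (a d i) \<subseteq> univ M" "set (b d I) \<subseteq> univ M" for d i I
    using a[of d i] b[of d I] by (simp_all add: tuples_def)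
  then have EM: "E \<subseteq> univ M" using m unfolding E_def by blast
  obtain h :: "('f, 'p) fm \<Rightarrow> 'm" where h: "range c \<subseteq> range h"
    "is_structure L (M\<lparr>univ := range h\<rparr>)"
    "\<And>e \<phi>. range e \<subseteq> range h \<Longrightarrow> sat (M\<lparr>univ := range h\<rparr>) e \<phi> \<longleftrightarrow> sat M e \<phi>"
    "range h \<subseteq> univ M"
    by (rule downward_Loewenheim_Skolem[OF structM, of c]) (use rc EM in auto)
  define M0 where "M0 = M\<lparr>univ := range h\<rparr>"
  have univ0: "univ M0 = range h" by (simp add: M0_def)
  have mh: "m \<in> range h" using h(1) rc by (auto simp: E_def)
  have model0: "is_model L T M0"
    using M h(2,3,4) unfolding is_model_def holds_def M0_def by (auto simp: subset_iff)
  have sat0: "sat_at M0 \<phi> x y as bs \<longleftrightarrow> sat_at M \<phi> x y as bs"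
    if "as \<in> tuples M0 (length x)" "bs \<in> tuples M0 (length y)" for as bs
  proof -
    have *: "length as = length x" "length bs = length y" "set as \<subseteq> range h" "set bs \<subseteq> range h"
      using that by (auto simp: tuples_def univ0)
    show ?thesis
      unfolding sat_at_eq[OF \<phi> *(1,2), where m = m] M0_def
      by (intro h(3) assignment_range mh *)
  qed
  obtain U :: "nat filter" where U: "U \<le> sequentially" "U \<noteq> bot"
    "\<And>P. eventually P U \<or> eventually (\<lambda>n. \<not> P n) U"
    using ultrafilter_below[OF sequentially_bot] by blast
  obtain K :: "(nat \<Rightarrow> 'm) \<Rightarrow> ('f, 'p) fm set" where K:
    "\<And>g g'. range g \<subseteq> range h \<Longrightarrow> range g' \<subseteq> range h \<Longrightarrow>
      K g = K g' \<longleftrightarrow> eventually (\<lambda>n. g n = g' n) U"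
    using sequence_classes_code[of h U] by blast
  interpret ultrapower L M0 U K
  proof
    show "is_structure L M0" unfolding M0_def by (rule h(2))
    show "K g = K g' \<longleftrightarrow> eventually (\<lambda>n. g n = g' n) U"
      if "range g \<subseteq> univ M0" "range g' \<subseteq> univ M0" for g g'
      using K that unfolding univ0 .
  qed (rule U)+
  \<comment> \<open>Coordinate \<open>d\<close> uses the \<open>d\<close>-th shattered
    configuration; an infinite pattern \<open>I\<close> enters it through its part below
    \<open>d\<close>.\<close>
  define \<alpha> where "\<alpha> i d = a d i" for i d
  define \<beta> where "\<beta> I d = b d (I \<inter> {..<d})" for I d
  have set_a: "set (a d i) \<subseteq> range h" for d i
    using h(1) unfolding rc E_def by blast
  have set_b: "set (b d (I \<inter> {..<d})) \<subseteq> range h" for d I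
  proof -
    have "z \<in> E" if "z \<in> set (b d (I \<inter> {..<d}))" for z
      unfolding E_def using that
      by (intro insertI2 UnI2 UN_I[of d] UN_I[of "I \<inter> {..<d}"]) auto
    then show ?thesis using h(1) rc by blast
  qed
  have \<alpha>: "\<alpha> i d \<in> tuples M0 (length x)" for i d
    using a[of d i] set_a[of d i] by (simp add: \<alpha>_def tuples_def univ0)
  have \<beta>: "\<beta> I d \<in> tuples M0 (length y)" for I d
    using b[of d "I \<inter> {..<d}"] set_b[of d I] by (simp add: \<beta>_def tuples_def univ0)
  have "sat_at N \<phi> x y (lift_tuple (length x) (\<alpha> i)) (lift_tuple (length y) (\<beta> I)) \<longleftrightarrow> i \<in> I" for i I
  proof -
    \<comment> \<open>Since \<open>U\<close> lies below \<open>sequentially\<close>, almost every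
      \<open>d\<close> exceeds \<open>i\<close>, and there the configuration decides
      \<open>i \<in> I\<close> correctly.\<close>
    have "eventually (\<lambda>d. i < d) U" using U(1) eventually_gt_at_top[of i] by (auto simp: le_filter_def)
    then have "eventually (\<lambda>d. sat_at M0 \<phi> x y (\<alpha> i d) (\<beta> I d) = (i \<in> I)) U"
    proof eventually_elim
      case (elim d)
      show ?case unfolding sat0[OF \<alpha> \<beta>] using ab[OF elim, of "I \<inter> {..<d}"] elim by (simp add: \<alpha>_def \<beta>_def)
    qed
    from eventually_subst[OF this] show ?thesis
      unfolding Los_sat_at[OF \<phi> \<alpha> \<beta>] using U(2) by (simp add: eventually_const_iff)
  qed
  moreover have "lift_tuple (length x) (\<alpha> i) \<in> tuples N (length x)"
    "lift_tuple (length y) (\<beta> I) \<in> tuples N (length y)" for i I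
    using \<alpha> \<beta> by (auto intro: lift_tuple_in)
  ultimately have "has_IP_in N \<phi> x y"
    unfolding has_IP_in_def
    by (intro exI[of _ "\<lambda>i. lift_tuple (length x) (\<alpha> i)"] exI[of _ "\<lambda>I. lift_tuple (length y) (\<beta> I)"]) blast
  then show False using nip is_model_N[OF model0 T] \<phi> by (auto simp: NIP_def)
qed

section \<open>From average measures to averages of truth values\<close>

theorem theorem3p5:
  fixes L :: "('f, 'p) lang" and T :: "('f, 'p) fm set" and M :: "('f, 'p, 'm) struct"
    and \<Omega> :: "'w set" and \<B> :: "'w set set" and P :: "'w set \<Rightarrow> real"
    and M\<Omega> :: "('w \<Rightarrow> 'm) set"
    and \<phi> :: "('f, 'p) fm" and x y :: "nat list" and r s :: real
  assumes "complete_theory L T" and "NIP L T" and "is_model L T M"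
    and "atomless_fa_prob_space \<Omega> \<B> P" and "M\<Omega> = simple_randomization M \<Omega> \<B>"
    and "partitioned L \<phi> x y" and "r < s"
  shows "\<exists>N :: nat. \<not> (\<exists>\<mu> :: nat \<Rightarrow> 'm list set \<Rightarrow> real.
           (\<forall>i<N. is_average_measure L M x (\<mu> i)) \<and> shattered M \<phi> x y r s N \<mu>)"
proof -
  have T: "T \<subseteq> sentences L" using assms(1) by (simp add: complete_theory_def)
  obtain d where d: "\<forall>B. finite B \<longrightarrow> B \<subseteq> tuples M (length x) \<longrightarrow>
    (\<forall>C\<subseteq>B. \<exists>b\<in>tuples M (length y). \<forall>a\<in>B. sat_at M \<phi> x y a b \<longleftrightarrow> a \<in> C) \<longrightarrow> card B \<le> d"
    using NIP_finite_VC_dimension[OF assms(2) T assms(3,6)] by (elim exE)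
  obtain N where N: "\<forall>(n :: nat \<Rightarrow> nat) \<alpha> (t :: nat set \<Rightarrow> nat) \<beta>.
    (\<forall>i<N. 0 < n i \<and> (\<forall>l<n i. \<alpha> i l \<in> tuples M (length x))) \<longrightarrow>
    (\<forall>I\<subseteq>{..<N}. 0 < t I \<and> (\<forall>j<t I. \<beta> I j \<in> tuples M (length y))) \<longrightarrow>
    (\<exists>I\<subseteq>{..<N}. \<exists>i<N. if i \<in> I
      then r < (\<Sum>j<t I. (\<Sum>l<n i. of_bool (sat_at M \<phi> x y (\<alpha> i l) (\<beta> I j))) / real (n i)) / real (t I)
      else (\<Sum>j<t I. (\<Sum>l<n i. of_bool (sat_at M \<phi> x y (\<alpha> i l) (\<beta> I j))) / real (n i)) / real (t I) < s)"
    using averages_not_shattered[OF d \<open>r < s\<close>] by (elim exE)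
  have False if avg: "\<forall>i<N. is_average_measure L M x (\<mu> i)" and sh: "shattered M \<phi> x y r s N \<mu>" for \<mu>
  proof -
    obtain as where as: "\<And>i. i < N \<Longrightarrow> as i \<noteq> [] \<and> set (as i) \<subseteq> tuples M (length x) \<and>
      average_measure L M x (as i) (\<mu> i)"
      using avg unfolding is_average_measure_def by metis
    \<comment> \<open>The measure of \<open>\<phi>(x;b)\<close> is a normalised sum of truth values
      over the list \<open>as i\<close>, the form required by the combinatorial core.\<close>
    have \<mu>: "\<mu> i (solutions M \<phi> x y b) =
      (\<Sum>l<length (as i). of_bool (sat_at M \<phi> x y (as i ! l) b)) / real (length (as i))"
      if "i < N" "b \<in> tuples M (length y)" for i b
    proof -
      have "{..<length (as i)} \<inter> {l. sat_at M \<phi> x y (as i ! l) b} =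
        {j. j < length (as i) \<and> sat_at M \<phi> x y (as i ! j) b}" by auto
      then show ?thesis using as[OF that(1)] assms(6) that(2) by (simp add: average_measure_def)
    qed
    \<comment> \<open>Naming the shattering condition allows parameters to be chosen for all
      \<open>I\<close> at once.\<close>
    define wit where "wit I t b \<longleftrightarrow> 0 < t \<and> (\<forall>j<t. b j \<in> tuples M (length y)) \<and>
      (\<forall>i\<in>I. (1 / real t) * (\<Sum>j<t. \<mu> i (solutions M \<phi> x y (b j))) \<le> r) \<and>
      (\<forall>i\<in>{..<N} - I. (1 / real t) * (\<Sum>j<t. \<mu> i (solutions M \<phi> x y (b j))) \<ge> s)" for I t b
    have "\<exists>t b. wit I t b" if "I \<subseteq> {..<N}" for I
      using sh that unfolding shattered_def wit_def by simp
    then obtain t b where wit: "\<And>I. I \<subseteq> {..<N} \<Longrightarrow> wit I (t I) (b I)" by metis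
    have as': "\<forall>i<N. 0 < length (as i) \<and> (\<forall>l<length (as i). as i ! l \<in> tuples M (length x))"
      using as by (meson length_greater_0_conv nth_mem subsetD)
    have wit': "\<forall>I\<subseteq>{..<N}. 0 < t I \<and> (\<forall>j<t I. b I j \<in> tuples M (length y))"
      using wit by (simp add: wit_def)
    have "\<exists>I\<subseteq>{..<N}. \<exists>i<N. if i \<in> I
      then r < (\<Sum>j<t I. (\<Sum>l<length (as i). of_bool (sat_at M \<phi> x y (as i ! l) (b I j))) / real (length (as i))) / real (t I)
      else (\<Sum>j<t I. (\<Sum>l<length (as i). of_bool (sat_at M \<phi> x y (as i ! l) (b I j))) / real (length (as i))) / real (t I) < s"
      by (rule N[THEN spec, THEN spec, THEN spec, THEN spec, THEN mp, THEN mp]) (rule as' wit')+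
    then obtain I i where I: "I \<subseteq> {..<N}" "i < N" and *: "if i \<in> I
      then r < (\<Sum>j<t I. (\<Sum>l<length (as i). of_bool (sat_at M \<phi> x y (as i ! l) (b I j))) / real (length (as i))) / real (t I)
      else (\<Sum>j<t I. (\<Sum>l<length (as i). of_bool (sat_at M \<phi> x y (as i ! l) (b I j))) / real (length (as i))) / real (t I) < s"
      by blast
    have eq: "(\<Sum>j<t I. \<mu> i (solutions M \<phi> x y (b I j))) =
      (\<Sum>j<t I. (\<Sum>l<length (as i). of_bool (sat_at M \<phi> x y (as i ! l) (b I j))) / real (length (as i)))"
      using wit[OF I(1)] by (intro sum.cong refl \<mu> I(2)) (simp add: wit_def)
    have "if i \<in> I then r < 1 / real (t I) * (\<Sum>j<t I. \<mu> i (solutions M \<phi> x y (b I j)))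
      else 1 / real (t I) * (\<Sum>j<t I. \<mu> i (solutions M \<phi> x y (b I j))) < s"
      using * unfolding eq by (simp only: times_divide_eq_left mult_1)
    then show False using wit[OF I(1)] I(2) by (force simp: wit_def split: if_splits)
  qed
  then show ?thesis by blast
qed

end
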